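(* Let $m$ and $n$ be positive integers and $z\in\mathbb C\setminus(-\infty,0)$. Then $$E_{2m,2n,\mathrm{real}}\left(\det\Big(1+\frac z2A^tA\Big)\right)^{-1/2}=E_{m,n,\mathrm{complex}}\left(\det(1+zA^*A)\right)^{-1},$$ where on the left-hand side the expectation is over random real $2m\times2n$ matrices $A$ with i.i.d. standard Gaussian $N(0,1)$ entries (standard real Wishart ensemble), and on the right-hand side the expectation is over random complex $m\times n$ matrices $A=(a_{jk})$ with i.i.d. standard complex Gaussian entries, i.e. all $\Re a_{jk},\Im a_{jk}$ are i.i.d. $N(0,1/2)$ (standard complex Wishart ensemble).
   Context: $1$ inside a determinant is the identity matrix, $A^t$ is the transpose and $A^*$ the conjugate transpose. The power $-1/2$ on the left-hand side is understood as $\prod_i(1+\frac z2\lambda_i)^{-1/2}$ over the eigenvalues $\lambda_i\ge0$ of $A^tA$, with the principal branch in each factor (equivalently, the analytic continuation in $z$ from $z>0$, where it is the positive square root). *)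

theory Defs
  imports
    "HOL-Probability.Probability"
    "Jordan_Normal_Form.Schur_Decomposition"
begin

hide_const (open) Determinants.det Finite_Cartesian_Product.mat

definition std_real_gaussian :: "real measure" where
  "std_real_gaussian = density lborel (\<lambda>x. ennreal (std_normal_density x))"

text \<open>The second argument of \<^const>\<open>normal_density\<close> is the standard deviation, so the real
  and imaginary parts below have variance \<open>1/2\<close>.\<close>

definition std_complex_gaussian :: "complex measure" where
  "std_complex_gaussian =
    (let N = density lborel (\<lambda>x. ennreal (normal_density 0 (sqrt (1/2)) x))
     in distr (N \<Otimes>\<^sub>M N) borel (\<lambda>(x, y). Complex x y))"

text \<open>The ensembles live on functions giving the entry at each position of a \<open>p \<times> q\<close> matrix;
  the product measure makes the entries independent.\<close>

definition real_ensemble :: "nat \<Rightarrow> nat \<Rightarrow> (nat \<times> nat \<Rightarrow> real) measure" where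
  "real_ensemble p q = PiM ({..<p} \<times> {..<q}) (\<lambda>_. std_real_gaussian)"

definition complex_ensemble :: "nat \<Rightarrow> nat \<Rightarrow> (nat \<times> nat \<Rightarrow> complex) measure" where
  "complex_ensemble p q = PiM ({..<p} \<times> {..<q}) (\<lambda>_. std_complex_gaussian)"

text \<open>The power \<open>det (1 + w B) powr (-1/2)\<close>, taken factor by factor over the eigenvalues
  of the symmetric real matrix \<open>B\<close>. All complex eigenvalues of such a \<open>B\<close> are real, so the real
  roots of its characteristic polynomial, with multiplicity, are all of its eigenvalues.
  Complex \<open>powr\<close> is the principal branch.\<close>

definition det_inv_sqrt :: "complex \<Rightarrow> real mat \<Rightarrow> complex" where
  "det_inv_sqrt w B =
    (\<Prod>l\<in>#proots (char_poly B). (1 + w * complex_of_real l) powr (-1/2))"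

end

theory Submission
  imports Defs "HOL-Complex_Analysis.Conformal_Mappings"
begin

hide_const (open) Determinants.det Finite_Cartesian_Product.mat

text \<open>Write both integrands as Gaussian averages over an auxiliary vector. Choose a real \<open>\<tau>\<close> such
  that \<open>c = 1 + \<i> \<tau>\<close> satisfies \<open>Re (c z) > 0\<close> (or \<open>z = 0\<close>). For a standard complex Gaussian vector
  \<open>v\<close> in \<open>n\<close> dimensions,
  \<open>c\<^sup>-\<^sup>n det (1 + z A\<^sup>* A)\<^sup>-\<^sup>1 = E exp (- \<i> \<tau> |v|\<^sup>2 - c z |A v|\<^sup>2)\<close>,
  and for a standard real Gaussian vector \<open>x\<close> in \<open>2 n\<close> dimensions
  \<open>c\<^sup>-\<^sup>n det (1 + z/2 A\<^sup>t A)\<^sup>-\<^sup>1\<^sup>/\<^sup>2 = E exp (- \<i> \<tau> |x|\<^sup>2 / 2 - c z |A x|\<^sup>2 / 4)\<close>.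
  These averages are bounded by 1, so Fubini's theorem allows averaging over \<open>A\<close> first. Its rows are
  independent, which turns the two sides into the averages of
  \<open>exp (- \<i> \<tau> r) (1 + c z r)\<^sup>-\<^sup>m\<close> over \<open>r = |v|\<^sup>2\<close> and \<open>r = |x|\<^sup>2 / 2\<close>. These have the same distribution.
  The complex Gaussian formula is Gaussian elimination for Hermitian forms followed by analytic
  continuation. The real formula holds up to sign, since the square of the real average is the complex
  one, and the sign is found by continuity.\<close>

subsection \<open>Hermitian Gaussian integrals\<close>

text \<open>The block factorization \<open>U * L\<close>, with \<open>U\<close> unit upper
  triangular and \<open>L\<close> lower triangular, clears the last column above the pivot
  \<open>H n n\<close>. What remains in the upper block of \<open>L\<close> is the Schur complement,
  so one elimination step splits off one scalar factor.\<close>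

lemma det_schur_complement:
  fixes H :: "nat \<Rightarrow> nat \<Rightarrow> 'a :: field"
  assumes "H n n \<noteq> 0"
  shows "det (mat (Suc n) (Suc n) (\<lambda>(i,j). H i j))
    = H n n * det (mat n n (\<lambda>(i,j). H i j - H i n * H n j / H n n))"
proof -
  let ?S = "mat n n (\<lambda>(i,j). H i j - H i n * H n j / H n n)"
  let ?b = "mat n 1 (\<lambda>(i,_). H i n / H n n)"
  let ?r = "mat 1 n (\<lambda>(_,j). H n j)"
  let ?s = "mat 1 1 (\<lambda>_. H n n)"
  define U where "U = four_block_mat (1\<^sub>m n) ?b (0\<^sub>m 1 n) (1\<^sub>m 1)"
  define L where "L = four_block_mat ?S (0\<^sub>m n 1) ?r ?s"
  have UL: "mat (Suc n) (Suc n) (\<lambda>(i,j). H i j) = U * L"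
    using assms unfolding U_def L_def
    by (subst mult_four_block_mat[where ?nr1.0=n and ?n1.0=n and ?n2.0=1 and ?nr2.0=1 and ?nc1.0=n and ?nc2.0=1])
      (auto intro!: eq_matI simp: scalar_prod_def less_Suc_eq)
  have "U \<in> carrier_mat (n + 1) (n + 1)" "L \<in> carrier_mat (n + 1) (n + 1)"
    unfolding U_def L_def by (intro four_block_carrier_mat; simp)+
  then have "det (U * L) = det U * det L"
    by (rule det_mult)
  moreover have "det U = 1"
    unfolding U_def by (subst det_four_block_mat_lower_left_zero[where n=n and m=1]) auto
  moreover have "det L = det ?S * H n n"
    unfolding L_def by (subst det_four_block_mat_upper_right_zero[where n=n and m=1]) (auto simp: det_single)
  ultimately show ?thesis by (simp add: UL)
qed

section \<open>The standard real and complex Gaussian measures\<close>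

lemma space_std_gaussian [simp]: "space std_real_gaussian = UNIV" "space std_complex_gaussian = UNIV"
  by (auto simp: std_real_gaussian_def std_complex_gaussian_def Let_def)

lemma sets_std_gaussian [simp, measurable_cong]:
  "sets std_real_gaussian = sets borel" "sets std_complex_gaussian = sets borel"
  by (auto simp: std_real_gaussian_def std_complex_gaussian_def Let_def)

abbreviation half_gaussian :: "real measure" where
  "half_gaussian \<equiv> density lborel (\<lambda>x. ennreal (normal_density 0 (sqrt (1/2)) x))"

lemma prob_space_half_gaussian: "prob_space half_gaussian"
  by (rule prob_space_normal_density) simp

lemma borel_measurable_Complex [measurable (raw)]:
  "f \<in> borel_measurable M \<Longrightarrow> g \<in> borel_measurable M \<Longrightarrow> (\<lambda>x. Complex (f x) (g x)) \<in> borel_measurable M"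
  by (simp add: Complex_eq)

lemma borel_measurable_cnj [measurable]: "cnj \<in> borel_measurable borel"
  by (intro borel_measurable_continuous_onI continuous_intros)

lemma prob_space_std_real_gaussian: "prob_space std_real_gaussian"
  unfolding std_real_gaussian_def by (rule prob_space_normal_density) simp

lemma prob_space_std_complex_gaussian: "prob_space std_complex_gaussian"
proof -
  interpret prob_space half_gaussian by (rule prob_space_half_gaussian)
  interpret pair_prob_space half_gaussian half_gaussian ..
  show ?thesis
    unfolding std_complex_gaussian_def Let_def by (rule prob_space_distr) measurable
qed

interpretation std_real: prob_space std_real_gaussian by (rule prob_space_std_real_gaussian)
interpretation std_complex: prob_space std_complex_gaussian by (rule prob_space_std_complex_gaussian)

interpretation real_vectors: product_prob_space "\<lambda>_. std_real_gaussian" I for I ..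
interpretation complex_vectors: product_prob_space "\<lambda>_. std_complex_gaussian" I for I ..

lemma nn_integral_std_complex_gaussian:
  assumes [measurable]: "F \<in> borel_measurable borel"
  shows "(\<integral>\<^sup>+y. F y \<partial>std_complex_gaussian) = (\<integral>\<^sup>+p. \<integral>\<^sup>+q. F (Complex p q) \<partial>half_gaussian \<partial>half_gaussian)"
proof -
  interpret prob_space half_gaussian by (rule prob_space_half_gaussian)
  show ?thesis
    unfolding std_complex_gaussian_def Let_def
    by (subst nn_integral_distr, measurable, subst nn_integral_fst[symmetric]) (auto simp: split_beta')
qed

text \<open>Completing the square: the density of \<open>half_gaussian\<close> is proportional to
  \<open>exp (- (p\<^sup>2))\<close>, so the total exponent is - s (p + b/s)^2 + b^2/s, a constant
  multiple of a normal density with mean - b/s and variance 1/(2 s).\<close>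

lemma nn_integral_half_gaussian_exp:
  assumes "s > 0"
  shows "(\<integral>\<^sup>+p. ennreal (exp (- ((s - 1) * p\<^sup>2 + 2 * b * p))) \<partial>half_gaussian)
    = ennreal (exp (b\<^sup>2 / s) / sqrt s)"
proof -
  let ?N = "normal_density (- (b / s)) (1 / sqrt (2 * s))"
  interpret N: prob_space "density lborel ?N"
    using assms by (intro prob_space_normal_density) simp
  have *: "normal_density 0 (sqrt (1/2)) p * exp (- ((s - 1) * p\<^sup>2 + 2 * b * p))
      = exp (b\<^sup>2 / s) / sqrt s * ?N p" for p
  proof -
    have "exp (- (p\<^sup>2)) * exp (- ((s - 1) * p\<^sup>2 + 2 * b * p)) = exp (b\<^sup>2 / s) * exp (- (p + b/s)\<^sup>2 * s)"
      using assms unfolding exp_add[symmetric]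
      by (intro arg_cong[where f=exp]) (simp add: field_simps power2_eq_square)
    moreover have "sqrt (1 / s) = 1 / sqrt s" by (simp add: real_sqrt_divide)
    ultimately show ?thesis
      using assms by (simp add: normal_density_def power_divide real_sqrt_divide real_sqrt_mult field_simps)
  qed
  have "(\<integral>\<^sup>+p. ennreal (exp (- ((s - 1) * p\<^sup>2 + 2 * b * p))) \<partial>half_gaussian)
      = (\<integral>\<^sup>+p. ennreal (exp (b\<^sup>2 / s) / sqrt s) * ennreal (?N p) \<partial>lborel)"
    using assms by (subst nn_integral_density, measurable)
      (auto intro!: nn_integral_cong simp: * simp flip: ennreal_mult simp del: minus_add_distrib)
  also have "\<dots> = ennreal (exp (b\<^sup>2 / s) / sqrt s) * (\<integral>\<^sup>+p. ennreal (?N p) \<partial>lborel)"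
    by (rule nn_integral_cmult) measurable
  also have "(\<integral>\<^sup>+p. ennreal (?N p) \<partial>lborel) = 1"
    using N.emeasure_space_1 by (simp add: emeasure_density)
  finally show ?thesis by simp
qed

text \<open>The exponent separates into real and imaginary parts, and each contributes one factor 1
  / sqrt s. The coefficient is \<open>s - 1\<close> because the measure itself already carries exp
  (- |y|^2).\<close>

lemma nn_integral_std_complex_gaussian_exp:
  assumes "s > 0"
  shows "(\<integral>\<^sup>+y. ennreal (exp (- ((s - 1) * (cmod y)\<^sup>2 + 2 * Re (cnj y * b)))) \<partial>std_complex_gaussian)
    = ennreal (exp ((cmod b)\<^sup>2 / s) / s)"
proof -
  have *: "exp (- ((s - 1) * (cmod (Complex p q))\<^sup>2 + 2 * Re (cnj (Complex p q) * b)))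
     = exp (- ((s - 1) * p\<^sup>2 + 2 * Re b * p)) * exp (- ((s - 1) * q\<^sup>2 + 2 * Im b * q))" for p q
    by (simp add: exp_add[symmetric] cmod_power2 algebra_simps)
  show ?thesis
    apply (subst nn_integral_std_complex_gaussian, measurable)
    apply (simp only: * ennreal_mult exp_ge_zero)
    apply (subst nn_integral_cmult, measurable)
    apply (subst nn_integral_multc, measurable)
    using assms apply (simp only: nn_integral_half_gaussian_exp)
    apply (simp add: cmod_power2 add_divide_distrib exp_add flip: ennreal_mult)
    done
qed

section \<open>Hermitian forms and elimination of the last coordinate\<close>

definition sq_norm :: "nat \<Rightarrow> (nat \<Rightarrow> 'a::real_normed_field) \<Rightarrow> real" where
  "sq_norm n v = (\<Sum>j<n. (norm (v j))\<^sup>2)"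

definition herm_form :: "nat \<Rightarrow> (nat \<Rightarrow> nat \<Rightarrow> complex) \<Rightarrow> (nat \<Rightarrow> complex) \<Rightarrow> complex" where
  "herm_form n H v = (\<Sum>i<n. \<Sum>j<n. cnj (v i) * H i j * v j)"

text \<open>The three real terms add up to s |v n + b v / s|^2. This is the completion of the square
  in the last coordinate, and it leaves the form of the Schur complement in the other
  coordinates.\<close>

lemma herm_form_Suc:
  fixes H :: "nat \<Rightarrow> nat \<Rightarrow> complex"
  assumes herm: "\<And>i j. i < Suc n \<Longrightarrow> j < Suc n \<Longrightarrow> H j i = cnj (H i j)"
    and s: "H n n = complex_of_real s" "s \<noteq> 0"
  defines "b \<equiv> \<lambda>v. \<Sum>j<n. H n j * v j"
  shows "herm_form (Suc n) H v =
    herm_form n (\<lambda>i j. H i j - H i n * H n j / H n n) v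
    + of_real ((cmod (b v))\<^sup>2 / s + s * (cmod (v n))\<^sup>2 + 2 * Re (cnj (v n) * b v))"
proof -
  have cb: "(\<Sum>i<n. cnj (v i) * H i n) = cnj (b v)"
    unfolding b_def cnj_sum using herm[of n] by (intro sum.cong) auto
  have 1: "herm_form n (\<lambda>i j. H i j - H i n * H n j / H n n) v
      = herm_form n H v - (\<Sum>i<n. cnj (v i) * H i n) * b v / s"
    unfolding herm_form_def b_def sum_product sum_divide_distrib sum_subtractf[symmetric] s
    by (intro sum.cong refl) (simp add: algebra_simps)
  have 2: "herm_form (Suc n) H v = herm_form n H v + (\<Sum>i<n. cnj (v i) * H i n) * v n
      + cnj (v n) * b v + s * (cnj (v n) * v n)"
    unfolding herm_form_def b_def
    by (simp add: sum.distrib s sum_distrib_left sum_distrib_right mult_ac)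
  have 3: "cnj (b v) * v n + cnj (v n) * b v = of_real (2 * Re (cnj (v n) * b v))"
    by (auto simp: complex_eq_iff)
  have 4: "cnj x * x = of_real ((cmod x)\<^sup>2)" for x
    unfolding complex_norm_square by (rule mult.commute)
  show ?thesis
    unfolding of_real_add 3[symmetric] 1 2 cb 4 by simp
qed

lemma herm_form_cong: "(\<And>i. i < n \<Longrightarrow> v i = w i) \<Longrightarrow> herm_form n H v = herm_form n H w"
  unfolding herm_form_def by (intro sum.cong refl) auto

lemma sq_norm_Suc: "sq_norm (Suc n) v = sq_norm n v + (norm (v n))\<^sup>2"
  by (simp add: sq_norm_def)

lemma sq_norm_upd [simp]: "n \<le> k \<Longrightarrow> sq_norm n (v(k := y)) = sq_norm n v"
  unfolding sq_norm_def by (intro sum.cong) auto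

lemma measurable_sq_norm [measurable]:
  "sq_norm n \<in> borel_measurable (PiM {..<n} (\<lambda>_. std_complex_gaussian))"
  "sq_norm n \<in> borel_measurable (PiM {..<n} (\<lambda>_. std_real_gaussian))"
  unfolding sq_norm_def[abs_def] by measurable

lemma measurable_herm_form [measurable]:
  "herm_form n H \<in> borel_measurable (PiM {..<n} (\<lambda>_. std_complex_gaussian))"
  unfolding herm_form_def[abs_def] by measurable

text \<open>Induction on \<open>n\<close>, eliminating the last coordinate: the determinant gains
  the pivot \<open>s\<close> and the integral gains 1 / s. The term \<open>sq_norm n v\<close>
  cancels the weight contained in the Gaussian measure. Working with nonnegative integrals means
  that iterated integration needs no prior integrability; finiteness is part of the result.\<close>

lemma nn_integral_gaussian_herm_form:
  fixes H :: "nat \<Rightarrow> nat \<Rightarrow> complex"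
  assumes "\<And>i j. i < n \<Longrightarrow> j < n \<Longrightarrow> H j i = cnj (H i j)"
    and "\<And>v i. i < n \<Longrightarrow> v i \<noteq> 0 \<Longrightarrow> 0 < Re (herm_form n H v)"
  shows "\<exists>d>0. det (mat n n (\<lambda>(i,j). H i j)) = of_real d \<and>
    (\<integral>\<^sup>+v. ennreal (exp (sq_norm n v - Re (herm_form n H v))) \<partial>PiM {..<n} (\<lambda>_. std_complex_gaussian))
      = ennreal (1 / d)"
  using assms
proof (induction n arbitrary: H)
  case 0
  have "det (mat 0 0 (\<lambda>(i,j). H i j)) = 1"
    by (simp add: det_dim_zero)
  then show ?case
    by (intro exI[of _ 1]) (simp add: sq_norm_def herm_form_def PiM_empty)
next
  case (Suc n)
  define s where "s = Re (H n n)"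
  have Hnn: "H n n = complex_of_real s"
    using Suc.prems(1)[of n n] by (simp add: s_def complex_eq_iff)
  \<comment> \<open>Testing positivity on the last unit vector shows that the pivot is
    positive.\<close>
  have "herm_form (Suc n) H (\<lambda>i. if i = n then 1 else 0) = H n n"
    by (simp add: herm_form_def)
  then have s: "s > 0"
    using Suc.prems(2)[of n "\<lambda>i. if i = n then 1 else 0"] by (simp add: s_def)
  define b where "b = (\<lambda>v. \<Sum>j<n. H n j * v j)"
  define H' where "H' = (\<lambda>i j. H i j - H i n * H n j / H n n)"
  have form: "herm_form (Suc n) H v = herm_form n H' v
      + of_real ((cmod (b v))\<^sup>2 / s + s * (cmod (v n))\<^sup>2 + 2 * Re (cnj (v n) * b v))" for v
    unfolding H'_def b_def using s by (intro herm_form_Suc Suc.prems(1) Hnn) auto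
  have b_upd: "b (v(n := y)) = b v" for v y
    unfolding b_def by (intro sum.cong) auto
  have pos': "0 < Re (herm_form n H' v)" if "i < n" "v i \<noteq> 0" for v i
  proof -
    let ?y = "- b v / s" \<comment> \<open>minimizes the form in the last coordinate\<close>
    have "0 < Re (herm_form (Suc n) H (v(n := ?y)))"
      using that by (intro Suc.prems(2)[of i]) auto
    also have "herm_form n H' (v(n := ?y)) = herm_form n H' v"
      by (rule herm_form_cong) auto
    then have "herm_form (Suc n) H (v(n := ?y)) = herm_form n H' v"
      using s unfolding form b_upd
      by (simp add: norm_divide power_divide power2_eq_square[of s] complex_norm_square[symmetric] field_simps)
    finally show ?thesis .
  qed
  have "\<exists>d>0. det (mat n n (\<lambda>(i,j). H' i j)) = of_real d \<and>
    (\<integral>\<^sup>+v. ennreal (exp (sq_norm n v - Re (herm_form n H' v))) \<partial>PiM {..<n} (\<lambda>_. std_complex_gaussian))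
      = ennreal (1 / d)"
  proof (rule Suc.IH)
    fix i j assume "i < n" "j < n"
    then show "H' j i = cnj (H' i j)"
      using Suc.prems(1)[of i j] Suc.prems(1)[of i n] Suc.prems(1)[of n j] by (simp add: H'_def Hnn)
  qed (use pos' in blast)
  then obtain d where d: "d > 0" "det (mat n n (\<lambda>(i,j). H' i j)) = of_real d"
    and int: "(\<integral>\<^sup>+v. ennreal (exp (sq_norm n v - Re (herm_form n H' v))) \<partial>PiM {..<n} (\<lambda>_. std_complex_gaussian))
      = ennreal (1 / d)" by auto
  have "det (mat (Suc n) (Suc n) (\<lambda>(i,j). H i j)) = of_real (s * d)"
    using det_schur_complement[of H n] d(2) s by (simp add: Hnn H'_def)
  moreover have "(\<integral>\<^sup>+v. ennreal (exp (sq_norm (Suc n) v - Re (herm_form (Suc n) H v))) \<partial>PiM {..<Suc n} (\<lambda>_. std_complex_gaussian))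
    = ennreal (1 / (s * d))"
  proof -
    \<comment> \<open>Only the second factor depends on \<open>y\<close>; its integral produces exp
      (|b v|^2 / s) / s, which cancels the correction in the first factor.\<close>
    have *: "exp (sq_norm (Suc n) (v(n := y)) - Re (herm_form (Suc n) H (v(n := y))))
        = exp (sq_norm n v - Re (herm_form n H' v) - (cmod (b v))\<^sup>2 / s)
          * exp (- ((s - 1) * (cmod y)\<^sup>2 + 2 * Re (cnj y * b v)))" for v y
    proof -
      have "herm_form n H' (v(n := y)) = herm_form n H' v"
        by (rule herm_form_cong) auto
      then show ?thesis
        unfolding exp_add[symmetric] form b_upd sq_norm_Suc by (simp add: algebra_simps)
    qed
    have "(\<integral>\<^sup>+v. ennreal (exp (sq_norm (Suc n) v - Re (herm_form (Suc n) H v))) \<partial>PiM {..<Suc n} (\<lambda>_. std_complex_gaussian))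
      = (\<integral>\<^sup>+v. \<integral>\<^sup>+y. ennreal (exp (sq_norm (Suc n) (v(n := y)) - Re (herm_form (Suc n) H (v(n := y)))))
          \<partial>std_complex_gaussian \<partial>PiM {..<n} (\<lambda>_. std_complex_gaussian))"
      unfolding lessThan_Suc
      by (rule complex_vectors.product_nn_integral_insert) (auto simp: lessThan_Suc[symmetric])
    also have "\<dots> = (\<integral>\<^sup>+v. ennreal (exp (sq_norm n v - Re (herm_form n H' v) - (cmod (b v))\<^sup>2 / s))
          * ennreal (exp ((cmod (b v))\<^sup>2 / s) / s) \<partial>PiM {..<n} (\<lambda>_. std_complex_gaussian))"
      by (simp only: * ennreal_mult exp_ge_zero, subst nn_integral_cmult)
        (simp_all only: nn_integral_std_complex_gaussian_exp[OF s], measurable)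
    also have "\<dots> = (\<integral>\<^sup>+v. ennreal (1 / s) * ennreal (exp (sq_norm n v - Re (herm_form n H' v)))
          \<partial>PiM {..<n} (\<lambda>_. std_complex_gaussian))"
      using s by (intro nn_integral_cong) (simp flip: ennreal_mult exp_add)
    also have "\<dots> = ennreal (1 / s) * ennreal (1 / d)"
      by (subst nn_integral_cmult) (auto simp: int)
    also have "\<dots> = ennreal (1 / (s * d))"
      using s d(1) by (simp flip: ennreal_mult)
    finally show ?thesis .
  qed
  ultimately show ?case
    using s d(1) by (intro exI[of _ "s * d"]) auto
qed

subsection \<open>Analytic continuation\<close>

text \<open>The mean value inequality on the disc of radius |w|. It serves to dominate difference
  quotients under the integral sign.\<close>

lemma norm_exp_minus_1_le: "cmod (exp w - 1) \<le> cmod w * exp (cmod w)"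
proof -
  have "cmod (exp w - exp 0) \<le> exp (cmod w) * cmod (w - 0)"
  proof (rule field_differentiable_bound[where S="cball 0 (cmod w)" and f'=exp])
    fix z :: complex assume "z \<in> cball 0 (cmod w)"
    then show "cmod (exp z) \<le> exp (cmod w)"
      using norm_exp[of z] by (auto intro: order_trans)
  qed (auto intro!: derivative_eq_intros)
  then show ?thesis by (simp add: mult.commute)
qed

text \<open>Differentiation under the integral sign by dominated convergence. Integrability at the
  two real endpoints -e and e suffices: inside the strip the modulus of the integrand is at most the
  sum of the two endpoint integrands, and the margin to the boundary absorbs the factor
  \<open>X\<close> created by differentiation.\<close>

lemma holomorphic_on_integral_exp:
  fixes X Y :: "'a \<Rightarrow> real"
  assumes [measurable]: "X \<in> borel_measurable M" "Y \<in> borel_measurable M"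
    and int: "integrable M (\<lambda>x. exp (e * X x - Y x))" "integrable M (\<lambda>x. exp (- e * X x - Y x))"
  shows "(\<lambda>u. LINT x|M. exp (- (u * complex_of_real (X x) + complex_of_real (Y x)))) holomorphic_on {u. \<bar>Re u\<bar> < e}"
    (is "?f holomorphic_on ?S")
proof -
  let ?w = "\<lambda>x. exp (e * X x - Y x) + exp (- e * X x - Y x)"
  have bound: "exp (c * \<bar>X x\<bar> - b * X x - Y x) \<le> ?w x" if "\<bar>b\<bar> + c \<le> e" for b c x
  proof -
    have "c * \<bar>X x\<bar> - b * X x \<le> (\<bar>b\<bar> + c) * \<bar>X x\<bar>"
      by (simp add: distrib_right) (metis abs_ge_minus_self abs_mult)
    also have "\<dots> \<le> e * \<bar>X x\<bar>"
      using that by (intro mult_right_mono) auto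
    finally have "exp (c * \<bar>X x\<bar> - b * X x - Y x) \<le> exp (e * \<bar>X x\<bar> - Y x)"
      by simp
    also have "\<dots> \<le> ?w x"
      by (cases "X x \<ge> 0") auto
    finally show ?thesis .
  qed
  have integrable: "integrable M (\<lambda>x. exp (- (u * complex_of_real (X x) + complex_of_real (Y x))))"
    if "u \<in> ?S" for u
  proof (rule Bochner_Integration.integrable_bound[where f="?w"])
    show "AE x in M. norm (exp (- (u * complex_of_real (X x) + complex_of_real (Y x)))) \<le> norm (?w x)"
    proof (rule AE_I2)
      fix x
      show "norm (exp (- (u * complex_of_real (X x) + complex_of_real (Y x)))) \<le> norm (?w x)"
        using that bound[of "Re u" 0 x] by simp
    qed
  qed (use int in auto)
  have "(?f has_field_derivative
      (LINT x|M. - complex_of_real (X x) * exp (- (u * complex_of_real (X x) + complex_of_real (Y x))))) (at u)"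
    if u: "u \<in> ?S" for u
    unfolding DERIV_def tendsto_at_iff_sequentially comp_def
  proof (intro allI impI)
    fix h :: "nat \<Rightarrow> complex"
    assume "\<forall>i. h i \<in> UNIV - {0}" and h: "h \<longlonglongrightarrow> 0"
    then have h0: "h i \<noteq> 0" for i by auto
    \<comment> \<open>Half of the margin is spent on the increment, whose modulus is below
      \<open>d\<close> from index \<open>N\<close> on, and the other half on the linear factor, via
      |X| \<le> exp (d |X|) / d.\<close>
    define d where "d = (e - \<bar>Re u\<bar>) / 2"
    have d: "d > 0" "\<bar>Re u\<bar> + 2 * d = e"
      using u by (auto simp: d_def field_simps)
    obtain N where N: "\<And>i. i \<ge> N \<Longrightarrow> cmod (h i) < d"
      using LIMSEQ_D[OF h d(1)] by auto
    define E where "E = (\<lambda>x. exp (- (u * complex_of_real (X x) + complex_of_real (Y x))))"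
    have E_h: "exp (- ((u + k) * complex_of_real (X x) + complex_of_real (Y x))) = E x * exp (- k * X x)" for k x
      by (simp add: E_def algebra_simps flip: exp_add)
    have [measurable]: "E \<in> borel_measurable M"
      unfolding E_def by measurable
    show "(\<lambda>i. (?f (u + h i) - ?f u) / h i) \<longlonglongrightarrow> (LINT x|M. - complex_of_real (X x) * E x)"
    proof (rule LIMSEQ_offset[of _ N])
      have "(?f (u + h (i + N)) - ?f u) / h (i + N)
          = (LINT x|M. E x * (exp (- h (i + N) * X x) - 1) / h (i + N))" for i
      proof -
        have "cmod (h (i + N)) < d" by (rule N) simp
        then have "u + h (i + N) \<in> ?S"
          using abs_Re_le_cmod[of "h (i + N)"] d by auto
        from integrable[OF this] integrable[OF u] have
          "?f (u + h (i + N)) - ?f u = (LINT x|M. E x * exp (- h (i + N) * X x) - E x)"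
          unfolding E_h E_def[symmetric] by (rule Bochner_Integration.integral_diff[symmetric])
        also have "\<dots> / h (i + N) = (LINT x|M. (E x * exp (- h (i + N) * X x) - E x) / h (i + N))"
          by simp
        finally show ?thesis by (simp add: right_diff_distrib)
      qed
      then show "(\<lambda>i. (?f (u + h (i + N)) - ?f u) / h (i + N)) \<longlonglongrightarrow> (LINT x|M. - complex_of_real (X x) * E x)"
      proof (simp only:, intro integral_dominated_convergence[where w="\<lambda>x. ?w x / d"])
        show "AE x in M. (\<lambda>i. E x * (exp (- h (i + N) * X x) - 1) / h (i + N)) \<longlonglongrightarrow> - complex_of_real (X x) * E x"
        proof (rule AE_I2)
          fix x
          have "((\<lambda>k. exp (- k * complex_of_real (X x))) has_field_derivative - complex_of_real (X x)) (at 0)"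
            by (auto intro!: derivative_eq_intros)
          then have "(\<lambda>i. (exp (- h i * X x) - 1) / h i) \<longlonglongrightarrow> - complex_of_real (X x)"
            using h h0 by (simp add: DERIV_def tendsto_at_iff_sequentially comp_def)
          then have "(\<lambda>i. (exp (- h (i + N) * X x) - 1) / h (i + N)) \<longlonglongrightarrow> - complex_of_real (X x)"
            by (rule LIMSEQ_ignore_initial_segment)
          then show "(\<lambda>i. E x * (exp (- h (i + N) * X x) - 1) / h (i + N)) \<longlonglongrightarrow> - complex_of_real (X x) * E x"
            by (simp only: times_divide_eq_right[symmetric] mult.commute[of "- complex_of_real (X x)"]) (rule tendsto_mult_left)
        qed
        show "AE x in M. norm (E x * (exp (- h (i + N) * X x) - 1) / h (i + N)) \<le> ?w x / d" for i
        proof (rule AE_I2)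
          fix x
          let ?k = "h (i + N)"
          have k: "cmod ?k < d" by (rule N) simp
          have "cmod (exp (- ?k * X x) - 1) \<le> cmod ?k * \<bar>X x\<bar> * exp (cmod ?k * \<bar>X x\<bar>)"
            using norm_exp_minus_1_le[of "- ?k * X x"] by (simp add: norm_mult)
          also have "\<dots> \<le> cmod ?k * \<bar>X x\<bar> * exp (d * \<bar>X x\<bar>)"
            using k by (intro mult_left_mono) (auto intro!: mult_right_mono)
          also have "\<dots> \<le> cmod ?k * (exp (d * \<bar>X x\<bar>) / d) * exp (d * \<bar>X x\<bar>)"
          proof (intro mult_right_mono mult_left_mono)
            have "d * \<bar>X x\<bar> \<le> exp (d * \<bar>X x\<bar>)"
              using exp_ge_add_one_self[of "d * \<bar>X x\<bar>"] by linarith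
            then show "\<bar>X x\<bar> \<le> exp (d * \<bar>X x\<bar>) / d"
              using d(1) by (simp add: pos_le_divide_eq mult.commute)
          qed auto
          finally have "cmod (exp (- ?k * X x) - 1) / cmod ?k \<le> exp (2 * d * \<bar>X x\<bar>) / d"
            using h0[of "i + N"] by (simp add: field_simps flip: exp_add)
          then have "cmod (E x) * (cmod (exp (- ?k * X x) - 1) / cmod ?k) \<le> cmod (E x) * (exp (2 * d * \<bar>X x\<bar>) / d)"
            by (rule mult_left_mono) simp
          also have "\<dots> = exp (2 * d * \<bar>X x\<bar> - Re u * X x - Y x) / d"
            by (simp add: E_def algebra_simps flip: exp_add)
          also have "\<dots> \<le> ?w x / d"
            using d by (intro divide_right_mono bound) auto
          finally show "norm (E x * (exp (- ?k * X x) - 1) / ?k) \<le> ?w x / d"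
            by (simp add: norm_mult norm_divide)
        qed
        show "integrable M (\<lambda>x. ?w x / d)"
          using int by (intro integrable_divide_zero) auto
      qed auto
    qed
  qed
  then show ?thesis
    unfolding holomorphic_on_def field_differentiable_def
    using has_field_derivative_at_within by blast
qed

text \<open>By the Leibniz formula the determinant is a polynomial in the entries.\<close>

lemma holomorphic_on_det:
  assumes "\<And>i j. (\<lambda>u. g u i j) holomorphic_on S"
  shows "(\<lambda>u. det (mat n n (\<lambda>(i,j). g u i j))) holomorphic_on S"
proof -
  have "det (mat n n (\<lambda>(i,j). g u i j))
      = (\<Sum>p\<in>{p. p permutes {0..<n}}. signof p * (\<Prod>i=0..<n. g u i (p i)))" for u
    by (subst det_def'[of _ n]) (auto intro!: sum.cong prod.cong dest: permutes_in_image)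
  then show ?thesis
    using assms by (auto intro!: holomorphic_intros)
qed

text \<open>This is |A v|^2 for the matrix \<open>A\<close> with \<open>m\<close> rows,
  \<open>n\<close> columns and entries \<open>a\<close>.\<close>

definition row_form :: "nat \<Rightarrow> nat \<Rightarrow> (nat \<times> nat \<Rightarrow> 'a::real_normed_field) \<Rightarrow> (nat \<Rightarrow> 'a) \<Rightarrow> real" where
  "row_form m n a v = (\<Sum>k<m. (norm (\<Sum>j<n. a (k, j) * v j))\<^sup>2)"

lemma row_form_nonneg: "0 \<le> row_form m n a v"
  by (simp add: row_form_def sum_nonneg)

lemma measurable_row_form [measurable]:
  "row_form m n a \<in> borel_measurable (PiM {..<n} (\<lambda>_. std_complex_gaussian))"
  "row_form m n a' \<in> borel_measurable (PiM {..<n} (\<lambda>_. std_real_gaussian))"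
  unfolding row_form_def[abs_def] by measurable

text \<open>The entries of \<open>s + t A\<^sup>* A\<close> for the matrix \<open>A\<close> with \<open>m\<close> rows and entries \<open>a\<close>.\<close>

definition pencil :: "nat \<Rightarrow> complex \<Rightarrow> complex \<Rightarrow> (nat \<times> nat \<Rightarrow> complex) \<Rightarrow> nat \<Rightarrow> nat \<Rightarrow> complex" where
  "pencil m s t a i j = (if i = j then s else 0) + t * (\<Sum>k<m. cnj (a (k, i)) * a (k, j))"

text \<open>The inner product of \<open>v\<close> with A^* A v is |A v|^2; the rest is an
  interchange of finite sums.\<close>

lemma herm_form_pencil: "herm_form n (pencil m s t a) v = s * sq_norm n v + t * row_form m n a v"
proof -
  have "(\<Sum>i<n. \<Sum>j<n. cnj (v i) * (if i = j then s else 0) * v j) = (\<Sum>i<n. cnj (v i) * s * v i)"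
    by (intro sum.cong refl) (simp add: if_distrib[of "\<lambda>x. _ * x"] if_distrib[of "\<lambda>x. x * _"] cong: if_cong)
  also have "\<dots> = s * sq_norm n v"
    unfolding sq_norm_def of_real_sum sum_distrib_left complex_norm_square by (intro sum.cong) auto
  finally have 1: "(\<Sum>i<n. \<Sum>j<n. cnj (v i) * (if i = j then s else 0) * v j) = s * sq_norm n v" .
  have "(\<Sum>i<n. \<Sum>j<n. cnj (v i) * (t * (\<Sum>k<m. cnj (a (k, i)) * a (k, j))) * v j)
      = (\<Sum>i<n. \<Sum>j<n. \<Sum>k<m. t * ((a (k, j) * v j) * cnj (a (k, i) * v i)))"
    by (simp add: sum_distrib_left sum_distrib_right mult_ac)
  also have "\<dots> = (\<Sum>k<m. \<Sum>i<n. \<Sum>j<n. t * ((a (k, j) * v j) * cnj (a (k, i) * v i)))"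
    by (simp only: sum.swap[of _ "{..<m}"])
  also have "\<dots> = t * row_form m n a v"
  proof -
    have "(\<Sum>i<n. \<Sum>j<n. t * ((a (k, j) * v j) * cnj (a (k, i) * v i)))
        = t * of_real ((cmod (\<Sum>j<n. a (k, j) * v j))\<^sup>2)" for k
    proof -
      have "(\<Sum>i<n. \<Sum>j<n. (a (k, j) * v j) * cnj (a (k, i) * v i))
          = (\<Sum>j<n. a (k, j) * v j) * cnj (\<Sum>j<n. a (k, j) * v j)"
        unfolding cnj_sum sum_product by (rule sum.swap)
      then show ?thesis
        by (simp only: complex_norm_square sum_distrib_left[symmetric])
    qed
    then show ?thesis
      by (simp only: row_form_def of_real_sum sum_distrib_left)
  qed
  finally have 2: "(\<Sum>i<n. \<Sum>j<n. cnj (v i) * (t * (\<Sum>k<m. cnj (a (k, i)) * a (k, j))) * v j) = t * row_form m n a v" .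
  show ?thesis
    unfolding herm_form_def pencil_def by (simp only: distrib_left distrib_right sum.distrib 1 2)
qed

text \<open>For real s > 0 and t \<ge> 0 the matrix s + t A^* A is Hermitian and positive definite,
  so the formula for Hermitian forms applies. These real cases supply both the integrability and the
  identities from which the analytic continuation starts.\<close>

lemma gaussian_integral_pencil_real:
  fixes n :: nat
  assumes "s > 0" "t \<ge> 0"
  defines "M \<equiv> PiM {..<n} (\<lambda>_. std_complex_gaussian)"
  shows "integrable M (\<lambda>v. exp (- ((s - 1) * sq_norm n v + t * row_form m n a v)))"
    and "of_real (LINT v|M. exp (- ((s - 1) * sq_norm n v + t * row_form m n a v)))
      * det (mat n n (\<lambda>(i,j). pencil m s t a i j)) = 1"
proof -
  have form: "herm_form n (pencil m s t a) v = of_real (s * sq_norm n v + t * row_form m n a v)" for v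
    by (simp add: herm_form_pencil)
  have "\<exists>d>0. det (mat n n (\<lambda>(i,j). pencil m s t a i j)) = of_real d \<and>
    (\<integral>\<^sup>+v. ennreal (exp (sq_norm n v - Re (herm_form n (pencil m s t a) v))) \<partial>M) = ennreal (1 / d)"
    unfolding M_def
  proof (rule nn_integral_gaussian_herm_form)
    show "pencil m s t a j i = cnj (pencil m s t a i j)" for i j
      by (simp add: pencil_def mult.commute)
    show "0 < Re (herm_form n (pencil m s t a) v)" if "i < n" "v i \<noteq> 0" for v i
    proof -
      have "0 < (cmod (v i))\<^sup>2" using that by simp
      also have "\<dots> \<le> sq_norm n v"
        unfolding sq_norm_def using that by (intro member_le_sum) auto
      finally show ?thesis
        using assms row_form_nonneg[of m n a v] unfolding form
        by (simp add: add_pos_nonneg)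
    qed
  qed
  then obtain d where d: "d > 0" "det (mat n n (\<lambda>(i,j). pencil m s t a i j)) = of_real d"
    and *: "(\<integral>\<^sup>+v. ennreal (exp (sq_norm n v - Re (herm_form n (pencil m s t a) v))) \<partial>M) = ennreal (1 / d)"
    by auto
  have "(\<integral>\<^sup>+v. ennreal (exp (- ((s - 1) * sq_norm n v + t * row_form m n a v))) \<partial>M) = ennreal (1 / d)"
    unfolding *[symmetric] form by (simp add: algebra_simps)
  then have "has_bochner_integral M (\<lambda>v. exp (- ((s - 1) * sq_norm n v + t * row_form m n a v))) (1 / d)"
    using d(1) by (intro has_bochner_integral_nn_integral) (auto simp: M_def)
  then show "integrable M (\<lambda>v. exp (- ((s - 1) * sq_norm n v + t * row_form m n a v)))"
    and "of_real (LINT v|M. exp (- ((s - 1) * sq_norm n v + t * row_form m n a v)))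
      * det (mat n n (\<lambda>(i,j). pencil m s t a i j)) = 1"
    using d by (auto simp: has_bochner_integral_iff)
qed

text \<open>The product form of the conclusion also yields that the determinant does not vanish, so
  no separate argument for its invertibility is required later.\<close>

lemma gaussian_integral_pencil:
  fixes \<tau> :: real and t :: complex
  assumes "Re t > 0 \<or> t = 0"
  shows "(LINT v|PiM {..<n} (\<lambda>_. std_complex_gaussian).
      exp (- (\<i> * complex_of_real \<tau> * complex_of_real (sq_norm n v) + t * complex_of_real (row_form m n a v))))
    * det (mat n n (\<lambda>(i,j). pencil m (1 + \<i> * \<tau>) t a i j)) = 1"
proof -
  let ?M = "PiM {..<n} (\<lambda>_. std_complex_gaussian)"
  define \<alpha> \<beta> where "\<alpha> = Re t" and "\<beta> = Im t"
  have t: "t = \<alpha> + \<i> * \<beta>" by (simp add: \<alpha>_def \<beta>_def complex_eq_iff)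
  txt \<open>The Hermitian matrices \<open>1 + u \<tau> + (\<alpha> + u \<beta>) A\<^sup>* A\<close> are positive definite for real \<open>u\<close> near \<open>0\<close>;
    the case in question is \<open>u = \<i>\<close>, reached by analytic continuation in the strip \<open>\<bar>Re u\<bar> < e\<close>.\<close>
  obtain e where e: "e > 0" "e * \<bar>\<tau>\<bar> < 1" "e * \<bar>\<beta>\<bar> \<le> \<alpha>"
  proof (cases "t = 0")
    case True
    then show ?thesis
      by (intro that[of "1 / (1 + \<bar>\<tau>\<bar>)"]) (auto simp: \<alpha>_def \<beta>_def field_simps)
  next
    case False
    then have \<alpha>: "\<alpha> > 0" using assms by (simp add: \<alpha>_def)
    \<comment> \<open>The first bound keeps 1 + u \<tau> positive and the second keeps \<alpha> + u
      \<beta> nonnegative for |u| \<le> e0. Adding 1 in the denominators covers \<tau> = 0 and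
      \<beta> = 0.\<close>
    define e0 where "e0 = min (1 / (1 + \<bar>\<tau>\<bar>)) (\<alpha> / (1 + \<bar>\<beta>\<bar>))"
    have "e0 * \<bar>\<tau>\<bar> \<le> 1 / (1 + \<bar>\<tau>\<bar>) * \<bar>\<tau>\<bar>" "e0 * \<bar>\<beta>\<bar> \<le> \<alpha> / (1 + \<bar>\<beta>\<bar>) * \<bar>\<beta>\<bar>"
      by (intro mult_right_mono; simp add: e0_def)+
    moreover have "e0 > 0"
      using \<alpha> by (auto simp: e0_def intro!: divide_pos_pos add_pos_nonneg)
    moreover have "1 / (1 + \<bar>\<tau>\<bar>) * \<bar>\<tau>\<bar> < 1" "\<alpha> / (1 + \<bar>\<beta>\<bar>) * \<bar>\<beta>\<bar> \<le> \<alpha>"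
      using \<alpha> by (auto simp: field_simps)
    ultimately show ?thesis
      by (intro that[of e0]) linarith+
  qed
  \<comment> \<open>\<open>X\<close> collects the coefficient of the parameter \<open>u\<close> and
    \<open>Y\<close> the part free of it, so that u = \<i> recovers the exponent of the
    claim.\<close>
  define X Y where "X = (\<lambda>v. \<tau> * sq_norm n v + \<beta> * row_form m n a v)" and "Y = (\<lambda>v. \<alpha> * row_form m n a v)"
  have [measurable]: "X \<in> borel_measurable ?M" "Y \<in> borel_measurable ?M"
    by (auto simp: X_def Y_def)
  have pos: "1 + u * \<tau> > 0" "\<alpha> + u * \<beta> \<ge> 0" if "\<bar>u\<bar> \<le> e" for u
  proof -
    have "\<bar>u * \<tau>\<bar> \<le> e * \<bar>\<tau>\<bar>" "\<bar>u * \<beta>\<bar> \<le> e * \<bar>\<beta>\<bar>"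
      using that by (auto simp: abs_mult intro!: mult_right_mono)
    with e show "1 + u * \<tau> > 0" "\<alpha> + u * \<beta> \<ge> 0" by linarith+
  qed
  have XY: "- (u * X v + Y v) = - ((1 + u * \<tau> - 1) * sq_norm n v + (\<alpha> + u * \<beta>) * row_form m n a v)" for u v
    by (simp add: X_def Y_def algebra_simps)
  define f where "f = (\<lambda>u. LINT v|?M. exp (- (u * complex_of_real (X v) + complex_of_real (Y v))))"
  define D where "D = (\<lambda>u::complex. det (mat n n (\<lambda>(i,j). pencil m (1 + u * \<tau>) (\<alpha> + u * \<beta>) a i j)))"
  let ?S = "{u. \<bar>Re u\<bar> < e}"
  have "f holomorphic_on ?S"
    unfolding f_def
  proof (rule holomorphic_on_integral_exp)
    show "integrable ?M (\<lambda>x. exp (e * X x - Y x))"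
      using gaussian_integral_pencil_real(1)[OF pos[of "- e"], of n m a] e(1)
      unfolding XY[symmetric] by simp
    show "integrable ?M (\<lambda>x. exp (- e * X x - Y x))"
      using gaussian_integral_pencil_real(1)[OF pos[of e], of n m a] e(1)
      unfolding XY[symmetric] by simp
  qed auto
  moreover have "D holomorphic_on ?S"
    unfolding D_def
  proof (rule holomorphic_on_det)
    show "(\<lambda>u. pencil m (1 + u * \<tau>) (\<alpha> + u * \<beta>) a i j) holomorphic_on ?S" for i j
      by (cases "i = j") (auto simp: pencil_def intro!: holomorphic_intros)
  qed
  ultimately have hol: "(\<lambda>u. f u * D u - 1) holomorphic_on ?S"
    by (intro holomorphic_intros)
  have "f \<i> * D \<i> - 1 = 0"
  proof (rule analytic_continuation[OF hol])
    have S: "?S = {u. Re u < e} \<inter> {u. - e < Re u}" by auto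
    show "open ?S" unfolding S by (intro open_Int open_halfspace_Re_lt open_halfspace_Re_gt)
    show "connected ?S" unfolding S 
      by (intro convex_connected convex_Int convex_halfspace_Re_lt convex_halfspace_Re_gt)
    show "complex_of_real ` {- e<..<e} \<subseteq> ?S" by auto
    show "0 islimpt complex_of_real ` {- e<..<e}"
      unfolding islimpt_approachable
    proof (intro allI impI)
      fix r :: real assume "r > 0"
      then show "\<exists>x'\<in>complex_of_real ` {- e<..<e}. x' \<noteq> 0 \<and> dist x' 0 < r"
        using e(1) by (intro bexI[of _ "complex_of_real (min r e / 2)"] imageI)
          (auto simp: min_def simp del: of_real_divide)
    qed
    show "f z * D z - 1 = 0" if z: "z \<in> complex_of_real ` {- e<..<e}" for z
    proof -
      obtain u where u: "z = of_real u" "\<bar>u\<bar> \<le> e" using z by auto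
      have "f z = (LINT v|?M. complex_of_real (exp (- (u * X v + Y v))))"
        by (simp add: f_def u flip: exp_of_real)
      also have "\<dots> = of_real (LINT v|?M. exp (- (u * X v + Y v)))"
        by (rule integral_complex_of_real)
      finally show ?thesis
        using gaussian_integral_pencil_real(2)[OF pos[OF u(2)], of n m a]
        unfolding XY[symmetric] by (simp add: D_def u)
    qed
  qed (use e in auto)
  moreover have "f \<i> = (LINT v|?M. exp (- (\<i> * complex_of_real \<tau> * complex_of_real (sq_norm n v) + t * complex_of_real (row_form m n a v))))"
    unfolding f_def X_def Y_def t
    by (intro Bochner_Integration.integral_cong refl arg_cong[where f=exp]) (simp add: algebra_simps)
  ultimately show ?thesis by (simp add: D_def t)
qed

section \<open>Rank-one determinants and the average over a single row\<close>

lemma det_one_plus_rank_one: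
  fixes u v :: "nat \<Rightarrow> 'a :: field"
  shows "det (mat n n (\<lambda>(i,j). (if i = j then 1 else 0) + u i * v j)) = 1 + (\<Sum>i<n. v i * u i)"
proof -
  \<comment> \<open>evaluate the determinant of \<open>[[1, u], [-v, 1]]\<close> by eliminating either diagonal block\<close>
  let ?P = "mat (Suc n) (Suc n) (\<lambda>(i,j). if i = n then if j = n then 1 else - v j else if j = n then u i else if i = j then 1 else 0)"
  have "det ?P = det (mat n n (\<lambda>(i,j). (if i = j then 1 else 0) + u i * v j))"
    by (subst det_schur_complement) (auto intro!: arg_cong[where f=det] eq_matI)
  moreover have "det ?P = 1 + (\<Sum>i<n. v i * u i)"
  proof -
    let ?u = "mat n 1 (\<lambda>(i,_). u i)" and ?v = "mat 1 n (\<lambda>(_,j). - v j)"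
      and ?s = "mat 1 1 (\<lambda>_. 1 + (\<Sum>i<n. v i * u i))"
    define L where "L = four_block_mat (1\<^sub>m n) (0\<^sub>m n 1) ?v (1\<^sub>m 1)"
    define U where "U = four_block_mat (1\<^sub>m n) ?u (0\<^sub>m 1 n) ?s"
    have "?P = L * U"
      unfolding L_def U_def
      by (subst mult_four_block_mat[where ?nr1.0=n and ?n1.0=n and ?n2.0=1 and ?nr2.0=1 and ?nc1.0=n and ?nc2.0=1])
        (auto intro!: eq_matI simp: scalar_prod_def less_Suc_eq sum_negf atLeast0LessThan)
    moreover have "L \<in> carrier_mat (n + 1) (n + 1)" "U \<in> carrier_mat (n + 1) (n + 1)"
      unfolding U_def L_def by (intro four_block_carrier_mat; simp)+
    ultimately have "det ?P = det L * det U"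
      by (simp add: det_mult)
    moreover have "det L = 1"
      unfolding L_def by (subst det_four_block_mat_upper_right_zero[where n=n and m=1]) auto
    moreover have "det U = 1 + (\<Sum>i<n. v i * u i)"
      unfolding U_def by (subst det_four_block_mat_lower_left_zero[where n=n and m=1]) (auto simp: det_single)
    ultimately show ?thesis by simp
  qed
  ultimately show ?thesis by simp
qed

lemma det_pencil_row:
  "det (mat n n (\<lambda>(i,j). pencil 1 1 t (\<lambda>(k,j). v j) i j)) = 1 + t * sq_norm n v"
proof -
  have "mat n n (\<lambda>(i,j). pencil 1 1 t (\<lambda>(k,j). v j) i j)
      = mat n n (\<lambda>(i,j). (if i = j then 1 else 0) + (t * cnj (v i)) * v j)"
    by (auto intro!: eq_matI simp: pencil_def)
  then show ?thesis
    unfolding sq_norm_def of_real_sum sum_distrib_left complex_norm_square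
    by (simp only: det_one_plus_rank_one) (auto intro!: sum.cong)
qed

text \<open>The pencil formula with \<tau> = 0 and m = 1, with the roles exchanged: the sum of the
  products \<open>u j * v j\<close> is symmetric, so the fixed vector \<open>v\<close> acts as the
  only row of the matrix and the random row \<open>u\<close> as the integration variable.\<close>

lemma gaussian_integral_row:
  assumes "Re t > 0 \<or> t = 0"
  shows "(LINT u|PiM {..<n} (\<lambda>_. std_complex_gaussian).
      exp (- (t * complex_of_real ((cmod (\<Sum>j<n. u j * v j))\<^sup>2)))) = 1 / (1 + t * sq_norm n v)"
proof -
  have *: "(LINT u|PiM {..<n} (\<lambda>_. std_complex_gaussian).
      exp (- (t * complex_of_real ((cmod (\<Sum>j<n. u j * v j))\<^sup>2)))) * (1 + t * sq_norm n v) = 1"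
    using gaussian_integral_pencil[OF assms, of n 0 1 "\<lambda>(k,j). v j"]
    unfolding row_form_def by (simp add: det_pencil_row[unfolded One_nat_def] mult.commute)
  from * show ?thesis
    by (intro eq_divide_imp) auto
qed

subsection \<open>Real Gaussian integrals\<close>

text \<open>A single family \<open>lam\<close> must describe both the real roots used in
  \<open>det_inv_sqrt\<close> and the complex determinants of all pencils. The characteristic
  polynomial is therefore split over the complex numbers, its roots are shown to be real and
  nonnegative, and the factorization is carried back to the reals.\<close>

lemma gram_spectrum:
  fixes a :: "nat \<times> nat \<Rightarrow> real"
  obtains lam where
    "proots (char_poly (transpose_mat (mat m n a) * mat m n a)) = image_mset lam (mset_set {..<n})"
    "\<And>i. i < n \<Longrightarrow> lam i \<ge> 0"
    "\<And>s t. det (mat n n (\<lambda>(i,j). pencil m s t (\<lambda>k. of_real (a k)) i j)) = (\<Prod>i<n. s + t * of_real (lam i))"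
proof -
  let ?a = "\<lambda>k. complex_of_real (a k)"
  define B where "B = transpose_mat (mat m n a) * mat m n a"
  define Bc where "Bc = mat n n (\<lambda>(i,j). pencil m 0 1 ?a i j)"
  have B: "B \<in> carrier_mat n n" and Bc: "Bc \<in> carrier_mat n n"
    by (auto simp: B_def Bc_def)
  have Bc_B: "Bc = map_mat of_real B"
    by (auto intro!: eq_matI simp: B_def Bc_def pencil_def scalar_prod_def atLeast0LessThan)
  obtain as where as: "char_poly Bc = (\<Prod>a\<leftarrow>as. [:- a, 1:])" "length as = n"
    using char_poly_factorized[OF Bc] by auto
  define lam where "lam = (\<lambda>i. Re (as ! i))"
  have lam: "as ! i = of_real (lam i)" "lam i \<ge> 0" if "i < n" for i
  proof -
    have "poly (char_poly Bc) (as ! i) = 0"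
      using that as by (auto simp: poly_prod_list prod_list_zero_iff)
    then have "eigenvalue Bc (as ! i)"
      by (simp add: eigenvalue_root_char_poly[OF Bc])
    then obtain v where v: "v \<in> carrier_vec n" "v \<noteq> 0\<^sub>v n" "Bc *\<^sub>v v = (as ! i) \<cdot>\<^sub>v v"
      using Bc unfolding eigenvalue_def eigenvector_def by auto
    define w where "w = (\<lambda>i. v $ i)"
    obtain j where j: "j < n" "w j \<noteq> 0"
      using v(1,2) unfolding w_def by (metis carrier_vecD eq_vecI index_zero_vec)
    have "0 < (cmod (w j))\<^sup>2" using j by simp
    also have "\<dots> \<le> sq_norm n w"
      unfolding sq_norm_def using j by (intro member_le_sum) auto
    finally have pos: "sq_norm n w > 0" .
    have ev: "(\<Sum>l<n. pencil m 0 1 ?a k l * w l) = as ! i * w k" if "k < n" for k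
    proof -
      have "(Bc *\<^sub>v v) $ k = as ! i * w k"
        using that v(1) unfolding v(3) by (simp add: w_def)
      then show ?thesis
        using that v(1) by (simp add: Bc_def w_def scalar_prod_def atLeast0LessThan)
    qed
    \<comment> \<open>The eigenvalue equals the Rayleigh quotient |A w|^2 / |w|^2, hence is real and
      nonnegative.\<close>
    have "row_form m n ?a w = herm_form n (pencil m 0 1 ?a) w"
      by (simp add: herm_form_pencil)
    also have "\<dots> = (\<Sum>k<n. cnj (w k) * (as ! i * w k))"
      unfolding herm_form_def mult.assoc sum_distrib_left[symmetric] by (intro sum.cong refl) (simp add: ev)
    also have "\<dots> = as ! i * sq_norm n w"
      unfolding sq_norm_def of_real_sum sum_distrib_left complex_norm_square by (intro sum.cong) auto
    finally have "as ! i = of_real (row_form m n ?a w / sq_norm n w)"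
      using pos by (simp add: field_simps)
    then show "as ! i = of_real (lam i)" "lam i \<ge> 0"
      using pos row_form_nonneg[of m n ?a w] by (simp_all add: lam_def)
  qed
  have cpc: "char_poly Bc = (\<Prod>i<n. [:- complex_of_real (lam i), 1:])"
    unfolding as(1) by (subst prod.list_conv_set_nth) (auto simp: as(2) lam atLeast0LessThan intro!: prod.cong)
  interpret of_real_poly: map_poly_inj_comm_ring_hom "of_real :: real \<Rightarrow> complex" ..
  \<comment> \<open>All complex roots being real, the factorization descends because embedding the
    coefficients is injective.\<close>
  have "map_poly complex_of_real (char_poly B) = map_poly complex_of_real (\<Prod>i<n. [:- lam i, 1:])"
  proof -
    have "map_poly complex_of_real (char_poly B) = char_poly Bc"
      unfolding Bc_B by (rule of_real_hom.char_poly_hom[OF B, symmetric])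
    also have "\<dots> = map_poly complex_of_real (\<Prod>i<n. [:- lam i, 1:])"
      unfolding cpc of_real_poly.hom_prod by (simp add: of_real_hom.map_poly_pCons_hom)
    finally show ?thesis .
  qed
  then have cp: "char_poly B = (\<Prod>i<n. [:- lam i, 1:])"
    by (rule of_real_poly.injectivity)
  have "proots (char_poly B) = image_mset lam (mset_set {..<n})"
    unfolding cp by (subst proots_prod) (auto simp: sum_unfold_sum_mset)
  moreover have "det (mat n n (\<lambda>(i,j). pencil m s t ?a i j)) = (\<Prod>i<n. s + t * of_real (lam i))" for s t
  proof (cases "t = 0")
    case True
    have "mat n n (\<lambda>(i,j). pencil m s 0 ?a i j) = s \<cdot>\<^sub>m 1\<^sub>m n"
      by (auto intro!: eq_matI simp: pencil_def)
    then show ?thesis by (simp add: True)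
  next
    case False
    \<comment> \<open>For t \<noteq> 0 the pencil is a scalar multiple of a characteristic matrix,
      so its determinant is the characteristic polynomial at - s / t up to the factor (-
      t)^n.\<close>
    have "mat n n (\<lambda>(i,j). pencil m s t ?a i j) = (- t) \<cdot>\<^sub>m (- char_matrix Bc (- s / t))"
      using False Bc by (auto intro!: eq_matI simp: pencil_def Bc_def char_matrix_def field_simps)
    then have "det (mat n n (\<lambda>(i,j). pencil m s t ?a i j)) = (- t) ^ n * poly (char_poly Bc) (- s / t)"
      using Bc by (simp add: char_poly_matrix[OF Bc] char_matrix_def)
    also have "\<dots> = (\<Prod>i<n. (- t) * (- s / t - of_real (lam i)))"
      unfolding prod.distrib cpc poly_prod
      by (intro arg_cong2[where f="(*)"] prod.cong) auto
    also have "\<dots> = (\<Prod>i<n. s + t * of_real (lam i))"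
      using False by (intro prod.cong refl) (simp add: field_simps)
    finally show ?thesis .
  qed
  ultimately show ?thesis
    using lam(2) unfolding B_def by (intro that[of lam]) auto
qed

section \<open>A complex Gaussian vector as a pair of real ones\<close>

lemma half_gaussian_eq_distr: "half_gaussian = distr std_real_gaussian borel (\<lambda>x. x / sqrt 2)"
proof -
  have "distributed std_real_gaussian lborel (\<lambda>x. x) std_normal_density"
    unfolding distributed_def by (auto simp: std_real_gaussian_def intro!: distr_id2)
  from std_real.normal_density_affine[OF this, of "1 / sqrt 2" 0]
  have "distributed std_real_gaussian lborel (\<lambda>x. x / sqrt 2) (normal_density 0 (sqrt (1/2)))"
    by (simp add: real_sqrt_divide)
  then have "density lborel (normal_density 0 (sqrt (1/2))) = distr std_real_gaussian lborel (\<lambda>x. x / sqrt 2)"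
    by (simp add: distributed_def)
  also have "\<dots> = distr std_real_gaussian borel (\<lambda>x. x / sqrt 2)"
    by (rule distr_cong) auto
  finally show ?thesis .
qed

lemma nn_integral_std_complex_gaussian_scaled:
  assumes [measurable]: "F \<in> borel_measurable borel"
  shows "(\<integral>\<^sup>+y. F y \<partial>std_complex_gaussian)
    = (\<integral>\<^sup>+p. \<integral>\<^sup>+q. F (Complex (p / sqrt 2) (q / sqrt 2)) \<partial>std_real_gaussian \<partial>std_real_gaussian)"
proof -
  have *: "(\<integral>\<^sup>+q. F (Complex p q) \<partial>half_gaussian) = (\<integral>\<^sup>+q. F (Complex p (q / sqrt 2)) \<partial>std_real_gaussian)" for p
    unfolding half_gaussian_eq_distr by (subst nn_integral_distr) measurable
  show ?thesis
    unfolding nn_integral_std_complex_gaussian[OF assms] *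
    unfolding half_gaussian_eq_distr by (subst nn_integral_distr) measurable
qed

text \<open>The factors 1 / sqrt 2 turn variance 1 into variance 1/2. The restriction to the index
  set makes the value a point of the product space.\<close>

definition complex_vec :: "nat \<Rightarrow> (nat \<Rightarrow> real) \<times> (nat \<Rightarrow> real) \<Rightarrow> nat \<Rightarrow> complex" where
  "complex_vec n = (\<lambda>(x, y). \<lambda>j\<in>{..<n}. Complex (x j / sqrt 2) (y j / sqrt 2))"

lemma measurable_complex_vec [measurable]:
  "complex_vec n \<in> PiM {..<n} (\<lambda>_. std_real_gaussian) \<Otimes>\<^sub>M PiM {..<n} (\<lambda>_. std_real_gaussian)
    \<rightarrow>\<^sub>M PiM {..<n} (\<lambda>_. std_complex_gaussian)"
  unfolding complex_vec_def split_beta' Complex_eq by measurable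

lemma sq_norm_complex_vec: "sq_norm n (complex_vec n (x, y)) = (sq_norm n x + sq_norm n y) / 2"
  by (simp add: sq_norm_def complex_vec_def cmod_power2 power_divide sum_divide_distrib add_divide_distrib sum.distrib)

lemma row_form_complex_vec:
  "row_form m n (\<lambda>k. complex_of_real (a k)) (complex_vec n (x, y)) = (row_form m n a x + row_form m n a y) / 2"
proof -
  have "(\<Sum>j<n. complex_of_real (a (k, j)) * complex_vec n (x, y) j)
      = Complex ((\<Sum>j<n. a (k, j) * x j) / sqrt 2) ((\<Sum>j<n. a (k, j) * y j) / sqrt 2)" for k
    by (auto simp: complex_eq_iff complex_vec_def sum_divide_distrib intro!: sum.cong)
  then show ?thesis
    by (simp add: row_form_def cmod_power2 power_divide add_divide_distrib sum.distrib flip: sum_divide_distrib)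
qed

text \<open>Induction on \<open>n\<close>: the last complex coordinate is replaced by two real ones
  \<open>p\<close> and \<open>q\<close>, and Tonelli moves \<open>p\<close> past \<open>y\<close>,
  so that each real coordinate joins its own vector.\<close>

lemma nn_integral_complex_vec:
  assumes "F \<in> borel_measurable (PiM {..<n} (\<lambda>_. std_complex_gaussian))"
  shows "(\<integral>\<^sup>+v. F v \<partial>PiM {..<n} (\<lambda>_. std_complex_gaussian))
    = (\<integral>\<^sup>+x. \<integral>\<^sup>+y. F (complex_vec n (x, y)) \<partial>PiM {..<n} (\<lambda>_. std_real_gaussian) \<partial>PiM {..<n} (\<lambda>_. std_real_gaussian))"
  using assms
proof (induction n arbitrary: F)
  case 0
  show ?case
    by (simp add: PiM_empty nn_integral_count_space_finite complex_vec_def)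
next
  case (Suc n)
  let ?C = "PiM {..<n} (\<lambda>_. std_complex_gaussian)" and ?R = "PiM {..<n} (\<lambda>_. std_real_gaussian)"
  interpret RR: pair_sigma_finite ?R std_real_gaussian ..
  have F [measurable]: "F \<in> borel_measurable (PiM (insert n {..<n}) (\<lambda>_. std_complex_gaussian))"
    using Suc.prems by (simp add: lessThan_Suc)
  have cv: "complex_vec (Suc n) (x(n := p), y(n := q))
      = (complex_vec n (x, y))(n := Complex (p / sqrt 2) (q / sqrt 2))" for x y p q
    by (auto simp: complex_vec_def fun_eq_iff)
  have [measurable]: "complex_vec (Suc n) \<in> PiM (insert n {..<n}) (\<lambda>_. std_real_gaussian)
      \<Otimes>\<^sub>M PiM (insert n {..<n}) (\<lambda>_. std_real_gaussian) \<rightarrow>\<^sub>M PiM (insert n {..<n}) (\<lambda>_. std_complex_gaussian)"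
    using measurable_complex_vec[of "Suc n"] by (simp only: lessThan_Suc)
  have "(\<integral>\<^sup>+v. F v \<partial>PiM {..<Suc n} (\<lambda>_. std_complex_gaussian))
      = (\<integral>\<^sup>+v. \<integral>\<^sup>+w. F (v(n := w)) \<partial>std_complex_gaussian \<partial>?C)"
    unfolding lessThan_Suc by (rule complex_vectors.product_nn_integral_insert) auto
  also have "\<dots> = (\<integral>\<^sup>+x. \<integral>\<^sup>+y. \<integral>\<^sup>+w. F ((complex_vec n (x, y))(n := w)) \<partial>std_complex_gaussian \<partial>?R \<partial>?R)"
    by (rule Suc.IH) measurable
  also have "\<dots> = (\<integral>\<^sup>+x. \<integral>\<^sup>+y. \<integral>\<^sup>+p. \<integral>\<^sup>+q. F (complex_vec (Suc n) (x(n := p), y(n := q)))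
      \<partial>std_real_gaussian \<partial>std_real_gaussian \<partial>?R \<partial>?R)"
    unfolding cv
  proof (intro nn_integral_cong nn_integral_std_complex_gaussian_scaled)
    fix x y
    have "complex_vec n (x, y) \<in> space ?C"
      by (auto simp: complex_vec_def space_PiM)
    from measurable_compose[OF measurable_component_update[OF this] F]
    have "(\<lambda>w. F ((complex_vec n (x, y))(n := w))) \<in> borel_measurable std_complex_gaussian"
      by simp
    then show "(\<lambda>w. F ((complex_vec n (x, y))(n := w))) \<in> borel_measurable borel"
      by (simp cong: measurable_cong_sets)
  qed
  also have "\<dots> = (\<integral>\<^sup>+x. \<integral>\<^sup>+p. \<integral>\<^sup>+y. \<integral>\<^sup>+q. F (complex_vec (Suc n) (x(n := p), y(n := q)))
      \<partial>std_real_gaussian \<partial>?R \<partial>std_real_gaussian \<partial>?R)"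
  proof (intro nn_integral_cong)
    fix x assume [measurable]: "x \<in> space ?R"
    show "(\<integral>\<^sup>+y. \<integral>\<^sup>+p. \<integral>\<^sup>+q. F (complex_vec (Suc n) (x(n := p), y(n := q)))
        \<partial>std_real_gaussian \<partial>std_real_gaussian \<partial>?R)
      = (\<integral>\<^sup>+p. \<integral>\<^sup>+y. \<integral>\<^sup>+q. F (complex_vec (Suc n) (x(n := p), y(n := q)))
        \<partial>std_real_gaussian \<partial>?R \<partial>std_real_gaussian)"
      by (rule RR.Fubini'[symmetric]) measurable
  qed
  also have "\<dots> = (\<integral>\<^sup>+x. \<integral>\<^sup>+p. \<integral>\<^sup>+y. F (complex_vec (Suc n) (x(n := p), y))
      \<partial>PiM {..<Suc n} (\<lambda>_. std_real_gaussian) \<partial>std_real_gaussian \<partial>?R)"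
  proof (intro nn_integral_cong)
    fix x p assume [measurable]: "x \<in> space ?R"
    show "(\<integral>\<^sup>+y. \<integral>\<^sup>+q. F (complex_vec (Suc n) (x(n := p), y(n := q))) \<partial>std_real_gaussian \<partial>?R)
      = (\<integral>\<^sup>+y. F (complex_vec (Suc n) (x(n := p), y)) \<partial>PiM {..<Suc n} (\<lambda>_. std_real_gaussian))"
      unfolding lessThan_Suc by (rule real_vectors.product_nn_integral_insert[symmetric]) auto
  qed
  also have "\<dots> = (\<integral>\<^sup>+x. \<integral>\<^sup>+y. F (complex_vec (Suc n) (x, y))
      \<partial>PiM {..<Suc n} (\<lambda>_. std_real_gaussian) \<partial>PiM {..<Suc n} (\<lambda>_. std_real_gaussian))"
    unfolding lessThan_Suc by (rule real_vectors.product_nn_integral_insert[symmetric]) auto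
  finally show ?case .
qed


text \<open>The identity of nonnegative integrals, applied to indicators, becomes an identity of
  measures and hence applies to complex integrands.\<close>

lemma distr_complex_vec:
  "distr (PiM {..<n} (\<lambda>_. std_real_gaussian) \<Otimes>\<^sub>M PiM {..<n} (\<lambda>_. std_real_gaussian))
    (PiM {..<n} (\<lambda>_. std_complex_gaussian)) (complex_vec n) = PiM {..<n} (\<lambda>_. std_complex_gaussian)"
    (is "distr (?R \<Otimes>\<^sub>M ?R) ?C _ = ?C")
proof (rule measure_eqI)
  fix A assume "A \<in> sets (distr (?R \<Otimes>\<^sub>M ?R) ?C (complex_vec n))"
  then have [measurable]: "A \<in> sets ?C" by simp
  have "emeasure (distr (?R \<Otimes>\<^sub>M ?R) ?C (complex_vec n)) A
      = (\<integral>\<^sup>+v. indicator A v \<partial>distr (?R \<Otimes>\<^sub>M ?R) ?C (complex_vec n))"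
    by simp
  also have "\<dots> = (\<integral>\<^sup>+xy. indicator A (complex_vec n xy) \<partial>(?R \<Otimes>\<^sub>M ?R))"
    by (rule nn_integral_distr) auto
  also have "\<dots> = (\<integral>\<^sup>+x. \<integral>\<^sup>+y. indicator A (complex_vec n (x, y)) \<partial>?R \<partial>?R)"
    by (rule real_vectors.nn_integral_fst[symmetric]) measurable
  also have "\<dots> = (\<integral>\<^sup>+v. indicator A v \<partial>?C)"
    by (rule nn_integral_complex_vec[symmetric]) measurable
  finally show "emeasure (distr (?R \<Otimes>\<^sub>M ?R) ?C (complex_vec n)) A = emeasure ?C A"
    by simp
qed simp

text \<open>Since the matrix is real, |v|^2 and |A v|^2 are half the sums of the corresponding real
  quantities of the two component vectors. The complex integrand is thus a product of two copies of
  the real one, and Fubini applies since its modulus is at most 1.\<close>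

lemma gaussian_integral_real_square:
  fixes \<tau> :: real and t :: complex and a :: "nat \<times> nat \<Rightarrow> real"
  assumes t: "Re t \<ge> 0"
  shows "(LINT x|PiM {..<n} (\<lambda>_. std_real_gaussian).
      exp (- ((\<i> * \<tau> * complex_of_real (sq_norm n x) + t * complex_of_real (row_form m n a x)) / 2)))\<^sup>2
    = (LINT v|PiM {..<n} (\<lambda>_. std_complex_gaussian).
      exp (- (\<i> * \<tau> * complex_of_real (sq_norm n v) + t * complex_of_real (row_form m n (\<lambda>k. complex_of_real (a k)) v))))"
    (is "(LINT x|?R. ?f x)\<^sup>2 = (LINT v|?C. ?g v)")
proof -
  interpret RR: pair_prob_space ?R ?R ..
  have "(LINT v|?C. ?g v) = (LINT v|distr (?R \<Otimes>\<^sub>M ?R) ?C (complex_vec n). ?g v)"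
    by (simp only: distr_complex_vec)
  also have "\<dots> = (LINT xy|(?R \<Otimes>\<^sub>M ?R). ?g (complex_vec n xy))"
    by (rule integral_distr) measurable
  also have "\<dots> = (LINT xy|(?R \<Otimes>\<^sub>M ?R). ?f (fst xy) * ?f (snd xy))"
    by (intro Bochner_Integration.integral_cong refl)
      (auto simp: sq_norm_complex_vec row_form_complex_vec exp_add[symmetric] field_simps intro!: arg_cong[where f=exp])
  also have "\<dots> = (LINT x|?R. LINT y|?R. ?f x * ?f y)"
  proof (subst RR.integral_fst'[symmetric])
    show "integrable (?R \<Otimes>\<^sub>M ?R) (\<lambda>xy. ?f (fst xy) * ?f (snd xy))"
    proof (rule RR.integrable_const_bound[where B=1])
      show "AE xy in ?R \<Otimes>\<^sub>M ?R. norm (?f (fst xy) * ?f (snd xy)) \<le> 1"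
        using t by (intro AE_I2) (simp add: norm_mult mult_le_one row_form_nonneg del: Re_divide_numeral)
    qed measurable
  qed simp
  also have "\<dots> = (LINT x|?R. ?f x)\<^sup>2"
    by (simp add: power2_eq_square)
  finally show ?thesis ..
qed

section \<open>Choosing the branch of the square root by continuity\<close>

lemma continuous_on_integral_exp:
  fixes X Y :: "'a \<Rightarrow> complex"
  assumes [measurable]: "X \<in> borel_measurable M" and "finite_measure M" and "\<And>x. Re (X x) \<ge> 0"
  shows "continuous_on {0..} (\<lambda>s::real. LINT x|M. exp (- (s * X x)))"
  unfolding continuous_on_sequentially comp_def
proof (intro allI ballI impI, elim conjE)
  fix s :: "nat \<Rightarrow> real" and l
  assume s: "\<forall>n. s n \<in> {0..}" "s \<longlonglongrightarrow> l"
  interpret finite_measure M by fact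
  show "(\<lambda>n. LINT x|M. exp (- (s n * X x))) \<longlonglongrightarrow> (LINT x|M. exp (- (l * X x)))"
  proof (rule integral_dominated_convergence[where w="\<lambda>_. 1"])
    show "AE x in M. (\<lambda>n. exp (- (s n * X x))) \<longlonglongrightarrow> exp (- (l * X x))"
      using s(2) by (intro AE_I2 tendsto_intros)
    show "AE x in M. norm (exp (- (s n * X x))) \<le> 1" for n
      using s(1) assms(3) by (intro AE_I2) simp
  qed auto
qed

lemma powr_minus_half_square: "w \<noteq> 0 \<Longrightarrow> (w powr (-1/2))\<^sup>2 = inverse (w :: complex)"
proof -
  assume "w \<noteq> 0"
  have "(w powr (-1/2))\<^sup>2 = w powr (-1/2 + -1/2)"
    by (simp only: power2_eq_square powr_add)
  with \<open>w \<noteq> 0\<close> show ?thesis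
    by (simp add: powr_minus)
qed

lemma gaussian_integral_real:
  fixes \<tau> :: real and t :: complex and a :: "nat \<times> nat \<Rightarrow> real" and lam :: "nat \<Rightarrow> real"
  assumes t: "Re t > 0 \<or> t = 0" and lam: "\<And>i. i < n \<Longrightarrow> lam i \<ge> 0"
    and det: "\<And>s t. det (mat n n (\<lambda>(i,j). pencil m s t (\<lambda>k. of_real (a k)) i j)) = (\<Prod>i<n. s + t * of_real (lam i))"
  shows "(LINT x|PiM {..<n} (\<lambda>_. std_real_gaussian).
      exp (- ((\<i> * \<tau> * complex_of_real (sq_norm n x) + t * complex_of_real (row_form m n a x)) / 2)))
    = (\<Prod>i<n. (1 + \<i> * \<tau> + t * complex_of_real (lam i)) powr (-1/2))"
proof -
  let ?R = "PiM {..<n} (\<lambda>_. std_real_gaussian)"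
  let ?X = "\<lambda>x. (\<i> * \<tau> * complex_of_real (sq_norm n x) + t * complex_of_real (row_form m n a x)) / 2"
  define r where "r = (\<lambda>s::real. LINT x|?R. exp (- (s * ?X x)))"
  define w where "w = (\<lambda>(s::real) i. 1 + s * (\<i> * \<tau> + t * complex_of_real (lam i)))"
  define p where "p = (\<lambda>s. \<Prod>i<n. w s i powr (-1/2))"
  have Re_t: "Re t \<ge> 0" using t by auto
  \<comment> \<open>Every factor stays in the right half-plane, away from the branch cut, so
    \<open>p\<close> is continuous and nonzero along the whole path.\<close>
  have w: "Re (w s i) > 0" if "s \<ge> 0" "i < n" for s i
    using that Re_t lam[of i] by (simp add: w_def add_pos_nonneg)
  then have w0: "w s i \<noteq> 0" if "s \<ge> 0" "i < n" for s i
    using that by (metis less_irrefl zero_complex.sel(1))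
  have p0: "p s \<noteq> 0" if "s \<ge> 0" for s
    using w0[OF that] by (simp add: p_def)
  \<comment> \<open>the sign is determined by continuity along the path from the zero form at \<open>s = 0\<close>\<close>
  have sq: "(r s)\<^sup>2 = (p s)\<^sup>2" if s: "s \<ge> 0" for s
  proof -
    have st: "Re (s * t) > 0 \<or> s * t = 0"
      using t s by (cases "s = 0") auto
    then have Re_st: "Re (s * t) \<ge> 0" by auto
    have "r s = (LINT x|?R. exp (- ((\<i> * complex_of_real (s * \<tau>) * complex_of_real (sq_norm n x) + (s * t) * complex_of_real (row_form m n a x)) / 2)))"
      unfolding r_def by (intro Bochner_Integration.integral_cong refl) (simp add: field_simps)
    then have "(r s)\<^sup>2 * (\<Prod>i<n. 1 + \<i> * complex_of_real (s * \<tau>) + (s * t) * of_real (lam i)) = 1"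
      using gaussian_integral_pencil[OF st, of n "s * \<tau>" m "\<lambda>k. complex_of_real (a k)"] Re_st
      by (simp only: gaussian_integral_real_square det)
    then have 1: "(r s)\<^sup>2 * (\<Prod>i<n. w s i) = 1"
      by (simp add: w_def algebra_simps)
    have "(p s)\<^sup>2 * (\<Prod>i<n. w s i) = (\<Prod>i<n. (w s i powr (-1/2))\<^sup>2 * w s i)"
      by (simp only: p_def prod_power_distrib prod.distrib)
    also have "\<dots> = 1"
      using w0[OF s] by (intro prod.neutral ballI, subst powr_minus_half_square) auto
    finally show ?thesis
      using 1 w0[OF s] by (metis (no_types, lifting) mult_cancel_right mult_zero_right zero_neq_one)
  qed
  have "continuous_on {0..} r"
    unfolding r_def
    by (rule continuous_on_integral_exp) 
      (use Re_t in \<open>auto simp: row_form_nonneg intro!: prob_space.finite_measure real_vectors.prob_space_axioms\<close>)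
  then have cont: "continuous_on {0..1} (\<lambda>s. r s / p s)"
    using w p0 unfolding p_def w_def
    by (intro continuous_intros) (auto intro: continuous_on_subset less_imp_le)
  \<comment> \<open>A continuous function on an interval with finitely many values is constant, and
    the ratio is 1 at s = 0.\<close>
  have "r s / p s \<in> {1, -1}" if "s \<ge> 0" for s
    using sq[OF that] p0[OF that] by (auto simp: power2_eq_iff)
  then have "(\<lambda>s. r s / p s) ` {0..1} \<subseteq> {1, -1}"
    by (intro image_subsetI) simp
  then have "finite ((\<lambda>s. r s / p s) ` {0..1})"
    by (rule finite_subset) simp
  from continuous_finite_range_constant[OF _ cont this]
  have "r 1 / p 1 = r 0 / p 0"
    by (auto simp: constant_on_def)
  also have "\<dots> = 1"
    by (simp add: r_def p_def w_def prob_space.prob_space[OF prob_space_PiM[OF prob_space_std_real_gaussian]])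
  finally have "r 1 = p 1"
    using p0[of 1] by simp
  then show ?thesis
    by (simp only: r_def p_def w_def add.assoc of_real_1 mult_1)
qed

text \<open>Both arguments lie strictly between - pi/2 and pi/2, so their difference stays within
  the principal range and the logarithms subtract.\<close>

lemma powr_divide_right_half_plane:
  fixes a c :: complex
  assumes "Re a > 0" "Re c > 0"
  shows "(a / c) powr s = a powr s / c powr s"
proof -
  have nz: "a \<noteq> 0" "c \<noteq> 0" using assms by auto
  have "\<bar>Im (Ln a)\<bar> < pi / 2" "\<bar>Im (Ln c)\<bar> < pi / 2"
    by (rule Re_Ln_pos_lt_imp; fact)+
  then have "- pi < Im (Ln a - Ln c)" "Im (Ln a - Ln c) \<le> pi"
    unfolding minus_complex.sel abs_less_iff by linarith+
  then have "Ln (exp (Ln a - Ln c)) = Ln a - Ln c"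
    by (rule Ln_exp)
  then have "Ln (a / c) = Ln a - Ln c"
    using nz by (simp add: exp_diff)
  then show ?thesis
    using nz by (simp add: powr_def right_diff_distrib exp_diff)
qed

text \<open>Each factor 1 + w l is written as (c + c w l) / c. Numerator and denominator lie in the
  right half-plane even where 1 + w l does not, so the principal power of the quotient splits and
  the numerators are evaluated by the real Gaussian integral.\<close>

lemma det_inv_sqrt_gram:
  fixes a :: "nat \<times> nat \<Rightarrow> real" and \<tau> :: real and w :: complex
  defines "c \<equiv> 1 + \<i> * \<tau>"
  assumes w: "Re (c * w) > 0 \<or> c * w = 0"
  shows "det_inv_sqrt w (transpose_mat (mat m n a) * mat m n a)
    = (c powr (1/2)) ^ n * (LINT x|PiM {..<n} (\<lambda>_. std_real_gaussian).
      exp (- ((\<i> * \<tau> * complex_of_real (sq_norm n x) + c * w * complex_of_real (row_form m n a x)) / 2)))"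
proof -
  obtain lam where proots: "proots (char_poly (transpose_mat (mat m n a) * mat m n a)) = image_mset lam (mset_set {..<n})"
    and lam: "\<And>i. i < n \<Longrightarrow> lam i \<ge> 0"
    and det: "\<And>s t. det (mat n n (\<lambda>(i,j). pencil m s t (\<lambda>k. of_real (a k)) i j)) = (\<Prod>i<n. s + t * of_real (lam i))"
    using gram_spectrum[of m n a] by blast
  have c: "Re c > 0" "c \<noteq> 0"
    by (auto simp: c_def complex_eq_iff)
  have "(1 + w * of_real (lam i)) powr (-1/2) = c powr (1/2) * (1 + \<i> * \<tau> + c * w * of_real (lam i)) powr (-1/2)"
    if "i < n" for i
  proof -
    have "Re (c * w) \<ge> 0" using w by auto
    then have "Re (c * w) * lam i \<ge> 0"
      using lam[OF that] by (rule mult_nonneg_nonneg)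
    then have "Re (c + c * w * of_real (lam i)) > 0"
      using c(1) by (simp add: algebra_simps)
    from powr_divide_right_half_plane[OF this c(1), of "-1/2"]
    have "((c + c * w * of_real (lam i)) / c) powr (-1/2) = c powr (1/2) * (c + c * w * of_real (lam i)) powr (-1/2)"
      by (simp add: powr_minus field_simps)
    moreover have "(c + c * w * of_real (lam i)) / c = 1 + w * of_real (lam i)"
      using c(2) by (simp add: field_simps)
    ultimately show ?thesis
      by (simp add: c_def)
  qed
  then have "det_inv_sqrt w (transpose_mat (mat m n a) * mat m n a)
      = (\<Prod>i<n. c powr (1/2) * (1 + \<i> * \<tau> + c * w * of_real (lam i)) powr (-1/2))"
    unfolding det_inv_sqrt_def proots image_mset.compositionality comp_def prod_unfold_prod_mset[symmetric]
    by (intro prod.cong) auto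
  also have "\<dots> = (c powr (1/2)) ^ n * (\<Prod>i<n. (1 + \<i> * \<tau> + c * w * of_real (lam i)) powr (-1/2))"
    by (simp only: prod.distrib prod_constant card_lessThan)
  also have "(\<Prod>i<n. (1 + \<i> * \<tau> + c * w * of_real (lam i)) powr (-1/2)) =
      (LINT x|PiM {..<n} (\<lambda>_. std_real_gaussian).
        exp (- ((\<i> * \<tau> * complex_of_real (sq_norm n x) + c * w * complex_of_real (row_form m n a x)) / 2)))"
    by (rule gaussian_integral_real[OF w lam det, symmetric])
  finally show ?thesis .
qed

subsection \<open>Averaging over the matrix\<close>

lemma mat_adjoint_mat: "mat_adjoint (mat m n a) = mat n m (\<lambda>(i,k). cnj (a (k, i)))"
  by (auto intro!: eq_matI simp: mat_adjoint_def mat_of_rows_def cols_def)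

text \<open>The pencil with coefficients c and c z is c times the matrix 1 + z A^* A, which accounts
  for the power c^n.\<close>

lemma inverse_det_gram:
  fixes a :: "nat \<times> nat \<Rightarrow> complex" and \<tau> :: real and z :: complex
  defines "c \<equiv> 1 + \<i> * \<tau>"
  assumes z: "Re (c * z) > 0 \<or> c * z = 0"
  shows "inverse (det (1\<^sub>m n + z \<cdot>\<^sub>m (mat_adjoint (mat m n a) * mat m n a)))
    = c ^ n * (LINT v|PiM {..<n} (\<lambda>_. std_complex_gaussian).
      exp (- (\<i> * \<tau> * complex_of_real (sq_norm n v) + c * z * complex_of_real (row_form m n a v))))"
proof -
  have "mat n n (\<lambda>(i,j). pencil m c (c * z) a i j) = c \<cdot>\<^sub>m (1\<^sub>m n + z \<cdot>\<^sub>m (mat_adjoint (mat m n a) * mat m n a))"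
    by (auto intro!: eq_matI simp: mat_adjoint_mat pencil_def scalar_prod_def atLeast0LessThan algebra_simps)
  then have "det (mat n n (\<lambda>(i,j). pencil m (1 + \<i> * \<tau>) (c * z) a i j))
      = c ^ n * det (1\<^sub>m n + z \<cdot>\<^sub>m (mat_adjoint (mat m n a) * mat m n a))"
    by (simp add: c_def[symmetric] mat_adjoint_mat)
  with gaussian_integral_pencil[OF z[unfolded c_def], of n \<tau> m a] show ?thesis
    by (intro inverse_unique) (simp only: c_def[symmetric] mult_ac)
qed

text \<open>The rows are restrictions of independent coordinates to disjoint index blocks, hence
  independent, and each has the law of a single row; the expectation of the product therefore
  factors.\<close>

lemma integral_prod_rows:
  fixes h :: "(nat \<Rightarrow> 'a) \<Rightarrow> complex"
  assumes "prob_space M" and int: "integrable (PiM {..<q} (\<lambda>_. M)) h" and pq: "0 < p" "0 < q"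
  shows "(LINT a|PiM ({..<p} \<times> {..<q}) (\<lambda>_. M). (\<Prod>k<p. h (\<lambda>j\<in>{..<q}. a (k, j))))
    = (LINT x|PiM {..<q} (\<lambda>_. M). h x) ^ p"
proof -
  let ?I = "{..<p} \<times> {..<q}" and ?Q = "PiM {..<q} (\<lambda>_. M)"
  let ?P = "PiM ?I (\<lambda>_. M)"
  let ?row = "\<lambda>k a. \<lambda>j\<in>{..<q}. a (k, j)"
  interpret M: prob_space M by fact
  interpret P: prob_space ?P by (rule prob_space_PiM) (rule assms(1))
  have [measurable]: "h \<in> borel_measurable ?Q"
    using int by (rule borel_measurable_integrable)
  have row: "distr ?P ?Q (?row k) = ?Q" if "k < p" for k
    using that distr_PiM_reindex[of ?I "\<lambda>_. M" "\<lambda>j. (k, j)" "{..<q}"] M.prob_space_axioms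
    by (auto simp: inj_on_def)
  have meas_row [measurable]: "?row k \<in> ?P \<rightarrow>\<^sub>M ?Q" if "k < p" for k
    using that by (intro measurable_restrict measurable_component_singleton) auto
  \<comment> \<open>On the product space, restriction to the full index set is the identity. The
    joint law of the coordinates is therefore the product of their marginals, which is the criterion
    for independence.\<close>
  have "distr ?P ?P (\<lambda>a. \<lambda>i\<in>?I. a i) = distr ?P ?P (\<lambda>a. a)"
    by (intro distr_cong refl) (auto simp: space_PiM PiE_def extensional_restrict)
  also have "\<dots> = PiM ?I (\<lambda>i. distr ?P M (\<lambda>a. a i))"
    unfolding distr_id by (intro PiM_cong refl distr_PiM_component[symmetric]) (auto simp: M.prob_space_axioms)
  finally have "P.indep_vars (\<lambda>_. M) (\<lambda>i a. a i) ?I"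
    using pq by (subst P.indep_vars_iff_distr_eq_PiM') (auto simp: lessThan_empty_iff)
  then have "P.indep_vars (\<lambda>k. PiM ({k} \<times> {..<q}) (\<lambda>_. M)) (\<lambda>k a. restrict (\<lambda>i. a i) ({k} \<times> {..<q})) {..<p}"
    by (rule P.indep_vars_restrict) (auto simp: disjoint_family_on_def)
  then have "P.indep_vars (\<lambda>_. borel) (\<lambda>k a. h (?row k (restrict (\<lambda>i. a i) ({k} \<times> {..<q})))) {..<p}"
  proof (rule P.indep_vars_compose2)
    fix k
    have "?row k \<in> PiM ({k} \<times> {..<q}) (\<lambda>_. M) \<rightarrow>\<^sub>M ?Q"
      by (intro measurable_restrict measurable_component_singleton) auto
    then show "(\<lambda>a. h (?row k a)) \<in> borel_measurable (PiM ({k} \<times> {..<q}) (\<lambda>_. M))"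
      by measurable
  qed
  also have "(\<lambda>k a. h (?row k (restrict (\<lambda>i. a i) ({k} \<times> {..<q})))) = (\<lambda>k a. h (?row k a))"
    by (intro ext arg_cong[where f=h]) auto
  finally have indep: "P.indep_vars (\<lambda>_. borel) (\<lambda>k a. h (?row k a)) {..<p}" .
  have "(LINT a|?P. (\<Prod>k<p. h (?row k a))) = (\<Prod>k<p. (LINT a|?P. h (?row k a)))"
  proof (rule P.indep_vars_lebesgue_integral[OF _ indep])
    show "integrable ?P (\<lambda>a. h (?row k a))" if "k \<in> {..<p}" for k
      using that int integrable_distr[OF meas_row, of k h] by (simp add: row)
  qed simp
  also have "\<dots> = (\<Prod>k<p. (LINT x|?Q. h x))"
  proof (intro prod.cong refl)
    fix k assume "k \<in> {..<p}"
    then show "(LINT a|?P. h (?row k a)) = (LINT x|?Q. h x)"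
      using integral_distr[OF meas_row, of k h] by (simp add: row)
  qed
  finally show ?thesis by simp
qed

lemma bounded_Fubini:
  fixes g :: "'a \<Rightarrow> 'b \<Rightarrow> complex"
  assumes "prob_space M" "prob_space N"
    and [measurable]: "case_prod g \<in> borel_measurable (M \<Otimes>\<^sub>M N)" and bound: "\<And>x y. cmod (g x y) \<le> 1"
  shows "integrable M (\<lambda>x. LINT y|N. g x y)"
    and "(LINT x|M. LINT y|N. g x y) = (LINT y|N. LINT x|M. g x y)"
proof -
  interpret M: prob_space M by fact
  interpret N: prob_space N by fact
  interpret MN: pair_prob_space M N ..
  have *: "integrable (M \<Otimes>\<^sub>M N) (case_prod g)"
    by (rule MN.integrable_const_bound[where B=1]) (auto simp: bound)
  show "integrable M (\<lambda>x. LINT y|N. g x y)"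
    using MN.integrable_fst'[OF *] by simp
  show "(LINT x|M. LINT y|N. g x y) = (LINT y|N. LINT x|M. g x y)"
    using MN.Fubini_integral[OF *] by simp
qed

lemma measurable_sq_norm_subset:
  assumes "{..<n} \<subseteq> I" and "sets M = sets borel"
  shows "sq_norm n \<in> borel_measurable (PiM I (\<lambda>_. M))"
proof -
  have "(\<lambda>x. x j) \<in> borel_measurable (PiM I (\<lambda>_. M))" if "j < n" for j
    using that assms measurable_component_singleton[of j I "\<lambda>_. M"]
    by (auto cong: measurable_cong_sets)
  then show ?thesis
    unfolding sq_norm_def[abs_def] by (intro borel_measurable_sum borel_measurable_power borel_measurable_norm) auto
qed

lemma cmod_exp_minus_le_1: "Re t \<ge> 0 \<Longrightarrow> r \<ge> 0 \<Longrightarrow> cmod (exp (- (t * complex_of_real r))) \<le> 1"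
  by simp

lemma exp_minus_row_form:
  "exp (- (w + t * complex_of_real (row_form m n a v)))
    = exp (- w) * (\<Prod>k<m. exp (- (t * complex_of_real ((norm (\<Sum>j<n. a (k, j) * v j))\<^sup>2))))"
  by (simp only: row_form_def of_real_sum sum_distrib_left minus_add_distrib exp_add sum_negf[symmetric]
      exp_sum[OF finite_lessThan])

text \<open>Both quantities are sums of \<open>n\<close> independent copies of (p^2 + q^2) / 2 with
  \<open>p\<close> and \<open>q\<close> standard normal. The induction matches two real coordinates
  with one complex coordinate.\<close>

lemma nn_integral_sq_norm_real_complex:
  assumes "\<phi> \<in> borel_measurable borel"
  shows "(\<integral>\<^sup>+x. \<phi> (sq_norm (2 * n) x / 2) \<partial>PiM {..<2 * n} (\<lambda>_. std_real_gaussian))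
    = (\<integral>\<^sup>+v. \<phi> (sq_norm n v) \<partial>PiM {..<n} (\<lambda>_. std_complex_gaussian))"
  using assms
proof (induction n arbitrary: \<phi>)
  case 0
  then show ?case by (simp add: PiM_empty sq_norm_def nn_integral_count_space_finite)
next
  case (Suc n)
  note [measurable] = Suc.prems
  \<comment> \<open>Averaging over the last pair gives a new test function, to which the induction
    hypothesis applies because it is stated for arbitrary \<phi>.\<close>
  define \<psi> where "\<psi> r = (\<integral>\<^sup>+p. \<integral>\<^sup>+q. \<phi> (r + (p\<^sup>2 + q\<^sup>2) / 2) \<partial>std_real_gaussian \<partial>std_real_gaussian)" for r
  have [measurable]: "\<psi> \<in> borel_measurable borel"
    unfolding \<psi>_def by measurable
  have "(\<integral>\<^sup>+x. \<phi> (sq_norm (2 * Suc n) x / 2) \<partial>PiM {..<2 * Suc n} (\<lambda>_. std_real_gaussian))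
    = (\<integral>\<^sup>+x. \<integral>\<^sup>+p. \<phi> ((sq_norm (Suc (2 * n)) x + p\<^sup>2) / 2) \<partial>std_real_gaussian \<partial>PiM {..<Suc (2 * n)} (\<lambda>_. std_real_gaussian))"
  proof -
    have [measurable]: "sq_norm (Suc (2 * n)) \<in> borel_measurable (PiM (insert (Suc (2 * n)) {..<Suc (2 * n)}) (\<lambda>_. std_real_gaussian))"
      by (intro measurable_sq_norm_subset) auto
    show ?thesis
      by (simp only: mult_Suc_right add_2_eq_Suc lessThan_Suc[of "Suc (2 * n)"], subst real_vectors.product_nn_integral_insert)
        (auto simp: sq_norm_Suc[of "Suc (2 * n)"])
  qed
  also have "\<dots> = (\<integral>\<^sup>+x. \<integral>\<^sup>+p. \<integral>\<^sup>+q. \<phi> ((sq_norm (2 * n) x + p\<^sup>2 + q\<^sup>2) / 2)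
      \<partial>std_real_gaussian \<partial>std_real_gaussian \<partial>PiM {..<2 * n} (\<lambda>_. std_real_gaussian))"
  proof -
    have [measurable]: "sq_norm (2 * n) \<in> borel_measurable (PiM (insert (2 * n) {..<2 * n}) (\<lambda>_. std_real_gaussian))"
      by (intro measurable_sq_norm_subset) auto
    show ?thesis
      by (simp only: lessThan_Suc[of "2 * n"], subst real_vectors.product_nn_integral_insert)
        (auto simp: sq_norm_Suc[of "2 * n"])
  qed
  also have "\<dots> = (\<integral>\<^sup>+x. \<psi> (sq_norm (2 * n) x / 2) \<partial>PiM {..<2 * n} (\<lambda>_. std_real_gaussian))"
    by (simp add: \<psi>_def add_divide_distrib add.assoc)
  also have "\<dots> = (\<integral>\<^sup>+v. \<psi> (sq_norm n v) \<partial>PiM {..<n} (\<lambda>_. std_complex_gaussian))"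
    by (rule Suc.IH) measurable
  also have "\<dots> = (\<integral>\<^sup>+v. \<integral>\<^sup>+w. \<phi> (sq_norm n v + (cmod w)\<^sup>2) \<partial>std_complex_gaussian \<partial>PiM {..<n} (\<lambda>_. std_complex_gaussian))"
    by (subst nn_integral_std_complex_gaussian_scaled)
      (auto simp: \<psi>_def cmod_power2 power_divide add_divide_distrib)
  also have "\<dots> = (\<integral>\<^sup>+v. \<phi> (sq_norm (Suc n) v) \<partial>PiM {..<Suc n} (\<lambda>_. std_complex_gaussian))"
  proof -
    have [measurable]: "sq_norm n \<in> borel_measurable (PiM (insert n {..<n}) (\<lambda>_. std_complex_gaussian))"
      by (intro measurable_sq_norm_subset) auto
    show ?thesis
      by (simp only: lessThan_Suc, subst complex_vectors.product_nn_integral_insert)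
        (auto simp: sq_norm_Suc)
  qed
  finally show ?case .
qed

lemma integral_sq_norm_real_complex:
  fixes \<phi> :: "real \<Rightarrow> complex"
  assumes [measurable]: "\<phi> \<in> borel_measurable borel"
  shows "(LINT x|PiM {..<2 * n} (\<lambda>_. std_real_gaussian). \<phi> (sq_norm (2 * n) x / 2))
    = (LINT v|PiM {..<n} (\<lambda>_. std_complex_gaussian). \<phi> (sq_norm n v))"
    (is "(LINT x|?R. _) = (LINT v|?C. _)")
proof -
  have "distr ?R borel (\<lambda>x. sq_norm (2 * n) x / 2) = distr ?C borel (sq_norm n)"
  proof (rule measure_eqI)
    fix A :: "real set" assume "A \<in> sets (distr ?R borel (\<lambda>x. sq_norm (2 * n) x / 2))"
    then have [measurable]: "A \<in> sets borel" by simp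
    have "(\<integral>\<^sup>+r. indicator A r \<partial>distr ?R borel (\<lambda>x. sq_norm (2 * n) x / 2)) = (\<integral>\<^sup>+r. indicator A r \<partial>distr ?C borel (sq_norm n))"
      by (subst (1 2) nn_integral_distr, measurable) (rule nn_integral_sq_norm_real_complex, measurable)
    then show "emeasure (distr ?R borel (\<lambda>x. sq_norm (2 * n) x / 2)) A = emeasure (distr ?C borel (sq_norm n)) A"
      by simp
  qed simp
  then have "(LINT r|distr ?R borel (\<lambda>x. sq_norm (2 * n) x / 2). \<phi> r) = (LINT r|distr ?C borel (sq_norm n). \<phi> r)"
    by simp
  then show ?thesis
    by (simp add: integral_distr)
qed

section \<open>The two ensemble expectations as averages over a squared norm\<close>

lemma measurable_row_form_pair [measurable]:
  "(\<lambda>(a, v). row_form m n a v) \<in> borel_measurable (PiM ({..<m} \<times> {..<n}) (\<lambda>_. std_complex_gaussian) \<Otimes>\<^sub>M PiM {..<n} (\<lambda>_. std_complex_gaussian))"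
  "(\<lambda>(a, x). row_form m n a x) \<in> borel_measurable (PiM ({..<m} \<times> {..<n}) (\<lambda>_. std_real_gaussian) \<Otimes>\<^sub>M PiM {..<n} (\<lambda>_. std_real_gaussian))"
  unfolding row_form_def split_beta' by measurable

text \<open>The representation of the inverse determinant has an integrand of modulus at most 1,
  because \<tau> enters only through an imaginary exponent and Re (c z) \<ge> 0. This gives
  integrability and allows the matrix to be averaged first; each of the \<open>m\<close> rows then
  contributes the same factor.\<close>

lemma complex_ensemble_integral:
  fixes \<tau> :: real and z :: complex and m n :: nat
  assumes mn: "m > 0" "n > 0"
  defines "c \<equiv> 1 + \<i> * \<tau>"
  assumes z: "Re (c * z) > 0 \<or> c * z = 0"
  shows "integrable (complex_ensemble m n) (\<lambda>a. inverse (det (1\<^sub>m n + z \<cdot>\<^sub>m (mat_adjoint (mat m n a) * mat m n a))))"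
    and "(LINT a|complex_ensemble m n. inverse (det (1\<^sub>m n + z \<cdot>\<^sub>m (mat_adjoint (mat m n a) * mat m n a))))
      = c ^ n * (LINT v|PiM {..<n} (\<lambda>_. std_complex_gaussian).
          exp (- (\<i> * \<tau> * sq_norm n v)) * (1 / (1 + c * z * sq_norm n v)) ^ m)"
proof -
  let ?C = "PiM {..<n} (\<lambda>_. std_complex_gaussian)" and ?E = "PiM ({..<m} \<times> {..<n}) (\<lambda>_. std_complex_gaussian)"
  let ?g = "\<lambda>a v. exp (- (\<i> * \<tau> * complex_of_real (sq_norm n v) + c * z * complex_of_real (row_form m n a v)))"
  have Re: "Re (c * z) \<ge> 0" using z by auto
  have bound: "cmod (?g a v) \<le> 1" for a v
    using Re by (simp add: row_form_nonneg del: times_complex.sel) (simp add: row_form_nonneg)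
  have prob: "prob_space ?E" "prob_space ?C"
    by (intro prob_space_PiM prob_space_std_complex_gaussian)+
  have meas: "case_prod ?g \<in> borel_measurable (?E \<Otimes>\<^sub>M ?C)"
    by measurable
  note Fubini = bounded_Fubini[OF prob meas bound]
  have inv: "inverse (det (1\<^sub>m n + z \<cdot>\<^sub>m (mat_adjoint (mat m n a) * mat m n a))) = c ^ n * (LINT v|?C. ?g a v)" for a
    using inverse_det_gram[of \<tau> z n m a] z unfolding c_def by simp
  show "integrable (complex_ensemble m n) (\<lambda>a. inverse (det (1\<^sub>m n + z \<cdot>\<^sub>m (mat_adjoint (mat m n a) * mat m n a))))"
    unfolding inv complex_ensemble_def by (intro integrable_mult_right Fubini)
  have "(LINT a|?E. ?g a v) = exp (- (\<i> * \<tau> * sq_norm n v)) * (1 / (1 + c * z * sq_norm n v)) ^ m" for v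
  proof -
    let ?h = "\<lambda>u. exp (- (c * z * complex_of_real ((cmod (\<Sum>j<n. u j * v j))\<^sup>2)))"
    have "(LINT a|?E. ?g a v) = (LINT a|?E. exp (- (\<i> * \<tau> * sq_norm n v)) * (\<Prod>k<m. ?h (\<lambda>j\<in>{..<n}. a (k, j))))"
      by (intro Bochner_Integration.integral_cong refl)
        (simp only: exp_minus_row_form, simp)
    also have "\<dots> = exp (- (\<i> * \<tau> * sq_norm n v)) * (LINT u|?C. ?h u) ^ m"
    proof -
      have "integrable ?C ?h"
        using Re by (intro complex_vectors.integrable_const_bound[where B=1] AE_I2 cmod_exp_minus_le_1) auto
      from integral_prod_rows[OF prob_space_std_complex_gaussian this mn] show ?thesis
        by (simp only: integral_mult_right_zero)
    qed
    also have "(LINT u|?C. ?h u) = 1 / (1 + c * z * sq_norm n v)"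
      by (rule gaussian_integral_row[OF z])
    finally show ?thesis .
  qed
  then show "(LINT a|complex_ensemble m n. inverse (det (1\<^sub>m n + z \<cdot>\<^sub>m (mat_adjoint (mat m n a) * mat m n a))))
      = c ^ n * (LINT v|?C. exp (- (\<i> * \<tau> * sq_norm n v)) * (1 / (1 + c * z * sq_norm n v)) ^ m)"
    unfolding inv complex_ensemble_def integral_mult_right_zero Fubini(2) by simp
qed

text \<open>The square suffices: the real matrix has an even number of rows, so its average is a
  power of this square and no root has to be chosen.\<close>

lemma gaussian_integral_row_real:
  fixes x :: "nat \<Rightarrow> real"
  assumes t: "Re t > 0 \<or> t = 0"
  shows "(LINT u|PiM {..<n} (\<lambda>_. std_real_gaussian).
      exp (- (t / 2 * complex_of_real ((\<bar>\<Sum>j<n. u j * x j\<bar>)\<^sup>2))))\<^sup>2 = 1 / (1 + t * sq_norm n x)"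
proof -
  have "(LINT u|PiM {..<n} (\<lambda>_. std_complex_gaussian).
      exp (- (t * complex_of_real ((cmod (\<Sum>j<n. u j * of_real (x j)))\<^sup>2)))) = 1 / (1 + t * sq_norm n x)"
    using gaussian_integral_row[OF t, of n "\<lambda>j. of_real (x j)"] by (simp add: sq_norm_def)
  moreover have "Re t \<ge> 0" using t by auto
  ultimately show ?thesis
    using gaussian_integral_real_square[of t n 0 1 "\<lambda>(k,j). x j"]
    by (simp add: row_form_def mult.commute)
qed

lemma real_ensemble_integral:
  fixes \<tau> :: real and z :: complex and m n :: nat
  assumes mn: "m > 0" "n > 0"
  defines "c \<equiv> 1 + \<i> * \<tau>"
  assumes z: "Re (c * z) > 0 \<or> c * z = 0"
  shows "integrable (real_ensemble (2*m) (2*n)) (\<lambda>a. det_inv_sqrt (z/2) (transpose_mat (mat (2*m) (2*n) a) * mat (2*m) (2*n) a))"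
    and "(LINT a|real_ensemble (2*m) (2*n). det_inv_sqrt (z/2) (transpose_mat (mat (2*m) (2*n) a) * mat (2*m) (2*n) a))
      = c ^ n * (LINT x|PiM {..<2*n} (\<lambda>_. std_real_gaussian).
          exp (- (\<i> * \<tau> * (sq_norm (2*n) x / 2))) * (1 / (1 + c * z * (sq_norm (2*n) x / 2))) ^ m)"
proof -
  let ?R = "PiM {..<2*n} (\<lambda>_. std_real_gaussian)" and ?E = "PiM ({..<2*m} \<times> {..<2*n}) (\<lambda>_. std_real_gaussian)"
  let ?g = "\<lambda>a x. exp (- ((\<i> * \<tau> * complex_of_real (sq_norm (2*n) x) + c * (z/2) * complex_of_real (row_form (2*m) (2*n) a x)) / 2))"
  have z2: "Re (c * (z/2)) > 0 \<or> c * (z/2) = 0" using z by auto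
  have Re: "Re (c * (z/2)) \<ge> 0" using z2 by auto
  have "c \<noteq> 0" by (auto simp: c_def complex_eq_iff)
  \<comment> \<open>The even number of columns turns the half powers of \<open>c\<close> into the
    same prefactor as on the complex side.\<close>
  then have c: "(c powr (1/2)) ^ (2*n) = c ^ n"
    by (simp add: power_mult power2_eq_square flip: powr_add)
  have bound: "cmod (?g a x) \<le> 1" for a x
    using Re by (simp add: row_form_nonneg)
  have prob: "prob_space ?E" "prob_space ?R"
    by (intro prob_space_PiM prob_space_std_real_gaussian)+
  have meas: "case_prod ?g \<in> borel_measurable (?E \<Otimes>\<^sub>M ?R)"
    by measurable
  note Fubini = bounded_Fubini[OF prob meas bound]
  have inv: "det_inv_sqrt (z/2) (transpose_mat (mat (2*m) (2*n) a) * mat (2*m) (2*n) a) = c ^ n * (LINT x|?R. ?g a x)" for a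
    using det_inv_sqrt_gram[of \<tau> "z/2" "2*m" "2*n" a] z2 c unfolding c_def by simp
  show "integrable (real_ensemble (2*m) (2*n)) (\<lambda>a. det_inv_sqrt (z/2) (transpose_mat (mat (2*m) (2*n) a) * mat (2*m) (2*n) a))"
    unfolding inv real_ensemble_def by (intro integrable_mult_right Fubini)
  have "(LINT a|?E. ?g a x) = exp (- (\<i> * \<tau> * (sq_norm (2*n) x / 2))) * (1 / (1 + c * z * (sq_norm (2*n) x / 2))) ^ m" for x
  proof -
    let ?h = "\<lambda>u. exp (- (c * (z/2) / 2 * complex_of_real ((\<bar>\<Sum>j<2*n. u j * x j\<bar>)\<^sup>2)))"
    have "(LINT a|?E. ?g a x) = (LINT a|?E. exp (- (\<i> * \<tau> * (sq_norm (2*n) x / 2))) * (\<Prod>k<2*m. ?h (\<lambda>j\<in>{..<2*n}. a (k, j))))"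
      by (intro Bochner_Integration.integral_cong refl)
        (simp only: add_divide_distrib mult.commute[of _ "complex_of_real (row_form _ _ _ _)"] times_divide_eq_right[symmetric],
         simp only: mult.commute[of "complex_of_real (row_form _ _ _ _)"] exp_minus_row_form, simp)
    also have "\<dots> = exp (- (\<i> * \<tau> * (sq_norm (2*n) x / 2))) * ((LINT u|?R. ?h u)\<^sup>2) ^ m"
    proof -
      have "integrable ?R ?h"
        using Re by (intro real_vectors.integrable_const_bound[where B=1] AE_I2 cmod_exp_minus_le_1) auto
      from integral_prod_rows[OF prob_space_std_real_gaussian this, of "2 * m"] mn show ?thesis
        by (simp only: integral_mult_right_zero power_mult)
    qed
    \<comment> \<open>The factor 1/2 accompanying \<open>z\<close> combines with |x|^2, so the
      result depends on r = |x|^2 / 2 exactly as the complex average depends on r = |v|^2.\<close>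
    also have "(LINT u|?R. ?h u)\<^sup>2 = 1 / (1 + c * (z/2) * sq_norm (2*n) x)"
      by (rule gaussian_integral_row_real[OF z2])
    finally show ?thesis by simp
  qed
  then show "(LINT a|real_ensemble (2*m) (2*n). det_inv_sqrt (z/2) (transpose_mat (mat (2*m) (2*n) a) * mat (2*m) (2*n) a))
      = c ^ n * (LINT x|?R. exp (- (\<i> * \<tau> * (sq_norm (2*n) x / 2))) * (1 / (1 + c * z * (sq_norm (2*n) x / 2))) ^ m)"
    unfolding inv real_ensemble_def integral_mult_right_zero Fubini(2) by simp
qed

theorem lemma1:
  fixes m n :: nat and z :: complex
  assumes "m > 0" and "n > 0"
    and "z \<notin> complex_of_real ` {..<0}"
  shows "integrable (real_ensemble (2*m) (2*n))
      (\<lambda>a. let A = mat (2*m) (2*n) a in det_inv_sqrt (z/2) (transpose_mat A * A)) \<and>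
    integrable (complex_ensemble m n)
      (\<lambda>a. let A = mat m n a in inverse (det (1\<^sub>m n + z \<cdot>\<^sub>m (mat_adjoint A * A)))) \<and>
    (LINT a|real_ensemble (2*m) (2*n).
      (let A = mat (2*m) (2*n) a in det_inv_sqrt (z/2) (transpose_mat A * A))) =
    (LINT a|complex_ensemble m n.
      (let A = mat m n a in inverse (det (1\<^sub>m n + z \<cdot>\<^sub>m (mat_adjoint A * A)))))"
proof -
  obtain \<tau> :: real where \<tau>: "Re ((1 + \<i> * \<tau>) * z) > 0 \<or> (1 + \<i> * \<tau>) * z = 0"
  proof (cases "Im z = 0")
    case True
    have "\<not> Re z < 0"
    proof
      assume "Re z < 0"
      moreover have "z = complex_of_real (Re z)"
        using True by (simp add: complex_eq_iff)
      ultimately show False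
        using assms(3) by blast
    qed
    then show ?thesis
      using True by (intro that[of 0]) (auto simp: complex_eq_iff)
  next
    case False
    \<comment> \<open>The real part of (1 + \<i> \<tau>) z is Re z - \<tau> Im z, and this \<tau>
      makes it equal to 1.\<close>
    then show ?thesis
      by (intro that[of "(Re z - 1) / Im z"]) simp
  qed
  \<comment> \<open>Up to the common factor (1 + \<i> \<tau>)^n, both expectations are averages of
    this function, over |x|^2 / 2 and |v|^2 respectively.\<close>
  let ?\<phi> = "\<lambda>r. exp (- (\<i> * \<tau> * complex_of_real r)) * (1 / (1 + (1 + \<i> * \<tau>) * z * complex_of_real r)) ^ m"
  have "(LINT x|PiM {..<2*n} (\<lambda>_. std_real_gaussian). ?\<phi> (sq_norm (2*n) x / 2))
      = (LINT v|PiM {..<n} (\<lambda>_. std_complex_gaussian). ?\<phi> (sq_norm n v))"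
    by (rule integral_sq_norm_real_complex) measurable
  then show ?thesis
    using real_ensemble_integral[OF assms(1,2) \<tau>] complex_ensemble_integral[OF assms(1,2) \<tau>]
    by (simp add: Let_def)
qed

end
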